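(* Let $\mathcal{G}$ be a countable family of analytic hypergraphs on a Polish space $X$ such that for each $G\in\mathcal{G}$ there is $n\in\omega$ such that $G$ has arity $\leq n$. If the poset $P_{I_{\mathcal{G}}}$ is proper, then it has the Sacks property.
   Context: For a Polish space $X$, $X^{\leq\omega}$ denotes the space of all finite sequences and all $\omega$-sequences of elements of $X$. A hypergraph on $X$ is a set $G\subset X^{\leq\omega}$; its elements are called edges. $G$ is analytic if it is an analytic subset of $X^{\leq\omega}$; it has arity $\leq n$ if each of its edges is a sequence of length at most $n$. A $G$-anticlique is a set $B\subset X$ with $B^{\leq\omega}\cap G=\emptyset$. For a countable collection $\mathcal{G}$ of hypergraphs on $X$, $I_{\mathcal{G}}$ is the $\sigma$-ideal on $X$ $\sigma$-generated by the Borel sets which are anticliques in at least one of the hypergraphs in $\mathcal{G}$. For a $\sigma$-ideal $I$, $P_I$ is the poset of Borel subsets of $X$ not in $I$, ordered by inclusion. A narrow tunnel is a function $T\colon\omega\to\mathcal{P}(\omega)$ such that $|T(n)|\leq 2^n$ for all $n\in\omega$. A point $x\in\omega^\omega$ is enclosed by $T$ if $x(n)\in T(n)$ for all $n\in\omega$. A poset $P$ has the Sacks property if every point of $\omega^\omega$ in the $P$-extension is enclosed by a ground model narrow tunnel. *)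

theory Defs
  imports "HOL-Analysis.Analysis"
begin

section \<open>Finite and infinite sequences, analytic sets\<close>

datatype 'a seq = Fin "'a list" | Inf "nat \<Rightarrow> 'a"

primrec entries :: "'a seq \<Rightarrow> 'a set" where
  "entries (Fin xs) = set xs"
| "entries (Inf f) = range f"

text \<open>
  The topology of the disjoint union of all finite powers of the space and of its countable power.
  A subset of the \<open>n\<close>-th power is open iff its preimage under the restriction map (which is open,
  continuous and surjective) is open in the product topology of the countable power; this avoids
  a separate treatment of the finite powers.
\<close>

definition open_seqs :: "'a::topological_space seq set \<Rightarrow> bool" where
  "open_seqs U \<longleftrightarrow>
     (\<forall>n. open {x :: nat \<Rightarrow> 'a. Fin (map x [0..<n]) \<in> U}) \<and> open {x. Inf x \<in> U}"

definition seq_topology :: "'a::topological_space seq topology" where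
  "seq_topology = topology open_seqs"

lemma istopology_open_seqs: "istopology open_seqs"
  unfolding istopology_def
proof (intro conjI allI impI)
  fix S T :: "'a seq set"
  assume "open_seqs S" "open_seqs T"
  then show "open_seqs (S \<inter> T)"
    by (auto simp: open_seqs_def Collect_conj_eq intro: open_Int)
next
  fix \<K> :: "'a seq set set"
  assume *: "\<forall>K\<in>\<K>. open_seqs K"
  have "{x :: nat \<Rightarrow> 'a. Fin (map x [0..<n]) \<in> \<Union>\<K>} = (\<Union>K\<in>\<K>. {x. Fin (map x [0..<n]) \<in> K})" for n
    by auto
  moreover have "{x. Inf x \<in> \<Union>\<K>} = (\<Union>K\<in>\<K>. {x. Inf x \<in> K})"
    by auto
  ultimately show "open_seqs (\<Union>\<K>)"
    using * by (auto simp: open_seqs_def intro!: open_UN)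
qed

lemma openin_seq_topology: "openin seq_topology U \<longleftrightarrow> open_seqs U"
  by (simp add: seq_topology_def topology_inverse' istopology_open_seqs)

lemma topspace_seq_topology: "topspace seq_topology = UNIV"
  using openin_subset[of seq_topology UNIV]
  by (auto simp: openin_seq_topology open_seqs_def)

definition analyticin :: "'a topology \<Rightarrow> 'a set \<Rightarrow> bool" where
  "analyticin X A \<longleftrightarrow>
     A = {} \<or> (\<exists>f :: (nat \<Rightarrow> nat) \<Rightarrow> 'a. continuous_map euclidean X f \<and> range f = A)"


section \<open>Hypergraphs and the associated \<open>\<sigma>\<close>-ideals\<close>

type_synonym 'a hypergraph = "'a seq set"

definition analytic_hypergraph :: "'a::topological_space hypergraph \<Rightarrow> bool" where
  "analytic_hypergraph G \<longleftrightarrow> analyticin seq_topology G"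

definition arity_le :: "'a hypergraph \<Rightarrow> nat \<Rightarrow> bool" where
  "arity_le G n \<longleftrightarrow> (\<forall>e\<in>G. \<exists>xs. e = Fin xs \<and> length xs \<le> n)"

definition anticlique :: "'a hypergraph \<Rightarrow> 'a set \<Rightarrow> bool" where
  "anticlique G B \<longleftrightarrow> {e. entries e \<subseteq> B} \<inter> G = {}"

definition sigma_ideal_generated :: "'a set set \<Rightarrow> 'a set set" where
  "sigma_ideal_generated \<S> = {A. \<exists>\<C>. countable \<C> \<and> \<C> \<subseteq> \<S> \<and> A \<subseteq> \<Union>\<C>}"

definition hypergraph_ideal :: "'a::topological_space hypergraph set \<Rightarrow> 'a set set" where
  "hypergraph_ideal \<G> =
     sigma_ideal_generated {B. B \<in> sets borel \<and> (\<exists>G\<in>\<G>. anticlique G B)}"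

text \<open>The poset associated with an ideal is this set of conditions, ordered by inclusion.\<close>

definition borel_positive :: "'a::topological_space set set \<Rightarrow> 'a set set" where
  "borel_positive I = {B. B \<in> sets borel \<and> B \<notin> I}"


section \<open>Dense and predense sets\<close>

text \<open>
  A poset is given by its set \<open>P\<close> of conditions and an order relation \<open>le\<close>, where \<open>le q p\<close> means
  that \<open>q\<close> is stronger than \<open>p\<close>.
\<close>

definition dense_in :: "'p set \<Rightarrow> ('p \<Rightarrow> 'p \<Rightarrow> bool) \<Rightarrow> 'p set \<Rightarrow> bool" where
  "dense_in P le D \<longleftrightarrow> D \<subseteq> P \<and> (\<forall>p\<in>P. \<exists>d\<in>D. le d p)"

definition compatible :: "'p set \<Rightarrow> ('p \<Rightarrow> 'p \<Rightarrow> bool) \<Rightarrow> 'p \<Rightarrow> 'p \<Rightarrow> bool" where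
  "compatible P le p q \<longleftrightarrow> (\<exists>r\<in>P. le r p \<and> le r q)"

definition predense_below :: "'p set \<Rightarrow> ('p \<Rightarrow> 'p \<Rightarrow> bool) \<Rightarrow> 'p \<Rightarrow> 'p set \<Rightarrow> bool" where
  "predense_below P le q E \<longleftrightarrow> (\<forall>r\<in>P. le r q \<longrightarrow> (\<exists>d\<in>E. compatible P le d r))"


section \<open>The structures \<open>H(\<theta>)\<close>\<close>

text \<open>
  \<open>('i, 'a) hset\<close> is \<open>H(\<theta>)\<close> over the urelements \<open>'a\<close>, where \<open>\<theta>\<close> is the successor of the
  cardinality of \<open>'i\<close>: its elements are the urelements and the well-founded sets all of whose
  hereditary members are urelements or sets of cardinality less than \<open>\<theta>\<close>. It is obtained from
  well-founded trees, where \<open>Node I f\<close> denotes the set \<open>{f i | i \<in> I}\<close> (the values of \<open>f\<close> outside \<open>I\<close>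
  are irrelevant), by identifying trees which denote the same set.
\<close>

datatype ('i, 'a) tree = Atom 'a | Node "'i set" "'i \<Rightarrow> ('i, 'a) tree"

inductive tree_eq :: "('i, 'a) tree \<Rightarrow> ('i, 'a) tree \<Rightarrow> bool" where
  "tree_eq (Atom a) (Atom a)"
| "\<lbrakk>\<forall>i\<in>I. \<exists>j\<in>J. tree_eq (f i) (g j); \<forall>j\<in>J. \<exists>i\<in>I. tree_eq (f i) (g j)\<rbrakk>
     \<Longrightarrow> tree_eq (Node I f) (Node J g)"

lemma tree_eq_simps [simp]:
  "tree_eq (Atom a) (Atom b) \<longleftrightarrow> a = b"
  "\<not> tree_eq (Atom a) (Node J g)"
  "\<not> tree_eq (Node I f) (Atom b)"
  "tree_eq (Node I f) (Node J g) \<longleftrightarrow>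
     (\<forall>i\<in>I. \<exists>j\<in>J. tree_eq (f i) (g j)) \<and> (\<forall>j\<in>J. \<exists>i\<in>I. tree_eq (f i) (g j))"
  by (subst tree_eq.simps, fastforce)+

lemma tree_eq_refl: "tree_eq s s"
  by (induction s) auto

lemma tree_eq_sym: "tree_eq s t \<Longrightarrow> tree_eq t s"
  by (induction rule: tree_eq.induct) auto

lemma tree_eq_trans: "tree_eq s t \<Longrightarrow> tree_eq t u \<Longrightarrow> tree_eq s u"
proof (induction arbitrary: u rule: tree_eq.induct)
  case (2 I J f g)
  then show ?case by (cases u) (simp_all, meson)
qed

quotient_type ('i, 'a) hset = "('i, 'a) tree" / tree_eq
  by (intro equivpI reflpI sympI transpI)
    (auto intro: tree_eq_refl tree_eq_sym tree_eq_trans)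

definition hatom :: "'a \<Rightarrow> ('i, 'a) hset" where
  "hatom a = abs_hset (Atom a)"

definition hmem :: "('i, 'a) hset \<Rightarrow> ('i, 'a) hset \<Rightarrow> bool" where
  "hmem x y \<longleftrightarrow> (\<exists>I f. y = abs_hset (Node I f) \<and> x \<in> (\<lambda>i. abs_hset (f i)) ` I)"

text \<open>
  \<open>d\<close> is the set of urelements \<open>D\<close>. The condition on the form of \<open>d\<close> is needed to distinguish the
  empty set from the urelements, which have no members either.
\<close>

definition is_set_of_atoms :: "('i, 'a) hset \<Rightarrow> 'a set \<Rightarrow> bool" where
  "is_set_of_atoms d D \<longleftrightarrow> (\<exists>I f. d = abs_hset (Node I (\<lambda>i. Atom (f i))) \<and> D = f ` I)"

lemma hmem_abs_Node: "hmem x (abs_hset (Node I f)) \<longleftrightarrow> (\<exists>i\<in>I. x = abs_hset (f i))"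
proof -
  have "(\<exists>i\<in>I. x = abs_hset (f i))"
    if "abs_hset (Node I f) = abs_hset (Node J g)" "j \<in> J" "x = abs_hset (g j)" for J g j
    using that by (simp add: hset.abs_eq_iff) (meson tree_eq_sym)
  then show ?thesis
    unfolding hmem_def by blast
qed

lemma not_hmem_hatom: "\<not> hmem x (hatom a)"
  by (auto simp: hmem_def hatom_def hset.abs_eq_iff)

lemma hatom_inject: "hatom a = hatom b \<longleftrightarrow> a = b"
  by (simp add: hatom_def hset.abs_eq_iff)

lemma hset_extensionality:
  assumes "x \<notin> range hatom" "y \<notin> range hatom" "\<And>z. hmem z x \<longleftrightarrow> hmem z y"
  shows "x = y"
proof -
  obtain s t where st: "x = abs_hset s" "y = abs_hset t"
    using Quotient3_abs_rep[OF Quotient3_hset] by metis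
  obtain I f where s: "s = Node I f"
    using assms(1) st(1) by (cases s) (auto simp: hatom_def)
  obtain J g where t: "t = Node J g"
    using assms(2) st(2) by (cases t) (auto simp: hatom_def)
  have eq: "(\<exists>i\<in>I. z = abs_hset (f i)) \<longleftrightarrow> (\<exists>j\<in>J. z = abs_hset (g j))" for z
    using assms(3)[of z] by (simp add: st s t hmem_abs_Node)
  have "\<exists>j\<in>J. tree_eq (f i) (g j)" if "i \<in> I" for i
    using eq[of "abs_hset (f i)"] that by (auto simp: hset.abs_eq_iff intro: tree_eq_refl)
  moreover have "\<exists>i\<in>I. tree_eq (f i) (g j)" if "j \<in> J" for j
    using eq[of "abs_hset (g j)"] that by (auto simp: hset.abs_eq_iff intro: tree_eq_refl tree_eq_sym)
  ultimately show ?thesis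
    by (simp add: st s t hset.abs_eq_iff)
qed


section \<open>Elementary submodels and properness\<close>

text \<open>
  Formulas in the language of set theory with additional predicates for the set of conditions and
  for the order. Variables are named by natural numbers.
\<close>

datatype fm =
    EqF nat nat
  | MemF nat nat
  | CondF nat
  | LeF nat nat
  | NegF fm
  | ConjF fm fm
  | ExF nat fm

text \<open>
  Satisfaction in the substructure with domain \<open>M\<close> of \<open>H(\<theta>)\<close> expanded by the poset \<open>(P, le)\<close> on
  urelements.
\<close>

primrec sat ::
  "'a set \<Rightarrow> ('a \<Rightarrow> 'a \<Rightarrow> bool) \<Rightarrow> ('i, 'a) hset set \<Rightarrow> (nat \<Rightarrow> ('i, 'a) hset) \<Rightarrow> fm \<Rightarrow> bool" where
  "sat P le M e (EqF x y) \<longleftrightarrow> e x = e y"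
| "sat P le M e (MemF x y) \<longleftrightarrow> hmem (e x) (e y)"
| "sat P le M e (CondF x) \<longleftrightarrow> (\<exists>p\<in>P. e x = hatom p)"
| "sat P le M e (LeF x y) \<longleftrightarrow> (\<exists>p\<in>P. \<exists>q\<in>P. e x = hatom p \<and> e y = hatom q \<and> le p q)"
| "sat P le M e (NegF \<phi>) \<longleftrightarrow> \<not> sat P le M e \<phi>"
| "sat P le M e (ConjF \<phi> \<psi>) \<longleftrightarrow> sat P le M e \<phi> \<and> sat P le M e \<psi>"
| "sat P le M e (ExF x \<phi>) \<longleftrightarrow> (\<exists>a\<in>M. sat P le M (e(x := a)) \<phi>)"

text \<open>
  As the two predicates are given by elements of \<open>H(\<theta>)\<close>, elementarity in the expanded structure
  amounts to elementarity in \<open>H(\<theta>)\<close> together with the requirement that the poset belongs to \<open>M\<close>.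
\<close>

definition elementary_submodel ::
  "'a set \<Rightarrow> ('a \<Rightarrow> 'a \<Rightarrow> bool) \<Rightarrow> ('i, 'a) hset set \<Rightarrow> bool" where
  "elementary_submodel P le M \<longleftrightarrow>
     M \<noteq> {} \<and> (\<forall>\<phi> e. range e \<subseteq> M \<longrightarrow> (sat P le M e \<phi> \<longleftrightarrow> sat P le UNIV e \<phi>))"

definition master_condition ::
  "'a set \<Rightarrow> ('a \<Rightarrow> 'a \<Rightarrow> bool) \<Rightarrow> ('i, 'a) hset set \<Rightarrow> 'a \<Rightarrow> bool" where
  "master_condition P le M q \<longleftrightarrow> q \<in> P \<and>
     (\<forall>d\<in>M. \<forall>D. is_set_of_atoms d D \<and> dense_in P le D \<longrightarrow>
        predense_below P le q {p \<in> D. hatom p \<in> M})"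

text \<open>
  The index type makes \<open>\<theta>\<close> the successor of the second iterated exponential of the cardinality of
  \<open>'a + nat\<close>, so \<open>H(\<theta>)\<close> contains the poset together with all sets of dense sets. Properness does
  not depend on \<open>\<theta>\<close> beyond that.
\<close>

definition proper_poset :: "'a set \<Rightarrow> ('a \<Rightarrow> 'a \<Rightarrow> bool) \<Rightarrow> bool" where
  "proper_poset P le \<longleftrightarrow>
     (\<forall>M :: (('a + nat) set set, 'a) hset set.
        countable M \<and> elementary_submodel P le M \<longrightarrow>
          (\<forall>p\<in>P. hatom p \<in> M \<longrightarrow> (\<exists>q\<in>P. le q p \<and> master_condition P le M q)))"


section \<open>Names for points of the Baire space and the Sacks property\<close>

text \<open>
  A relation between \<open>\<omega>\<close> and \<open>\<omega>\<close> in the extension is given by a name consisting of triples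
  \<open>(p, n, m)\<close>, where \<open>p\<close> is a condition: if \<open>F\<close> is the generic filter, then the name evaluates to
  \<open>{(n, m). \<exists>p\<in>F. (p, n, m) \<in> \<tau>}\<close>. Every subset of \<open>\<omega> \<times> \<omega>\<close> in the extension is given by
  such a name.
\<close>

type_synonym 'p rel_name = "('p \<times> nat \<times> nat) set"

definition dense_below :: "'p set \<Rightarrow> ('p \<Rightarrow> 'p \<Rightarrow> bool) \<Rightarrow> 'p \<Rightarrow> ('p \<Rightarrow> bool) \<Rightarrow> bool" where
  "dense_below P le p \<Phi> \<longleftrightarrow> (\<forall>q\<in>P. le q p \<longrightarrow> (\<exists>r\<in>P. le r q \<and> \<Phi> r))"

text \<open>\<open>p\<close> forces that \<open>(n, m)\<close> belongs to \<open>\<tau>\<close>.\<close>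

definition forces_val ::
  "'p set \<Rightarrow> ('p \<Rightarrow> 'p \<Rightarrow> bool) \<Rightarrow> 'p \<Rightarrow> 'p rel_name \<Rightarrow> nat \<Rightarrow> nat \<Rightarrow> bool" where
  "forces_val P le p \<tau> n m \<longleftrightarrow>
     dense_below P le p (\<lambda>r. \<exists>s\<in>P. (s, n, m) \<in> \<tau> \<and> le r s)"

text \<open>\<open>p\<close> forces that \<open>\<tau>\<close> is a function from \<open>\<omega>\<close> to \<open>\<omega>\<close>.\<close>

definition forces_function :: "'p set \<Rightarrow> ('p \<Rightarrow> 'p \<Rightarrow> bool) \<Rightarrow> 'p \<Rightarrow> 'p rel_name \<Rightarrow> bool" where
  "forces_function P le p \<tau> \<longleftrightarrow>
     (\<forall>n. dense_below P le p (\<lambda>r. \<exists>m. forces_val P le r \<tau> n m)) \<and>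
     (\<forall>n m m'. \<forall>q\<in>P. le q p \<and> forces_val P le q \<tau> n m \<and> forces_val P le q \<tau> n m' \<longrightarrow> m = m')"

definition narrow_tunnel :: "(nat \<Rightarrow> nat set) \<Rightarrow> bool" where
  "narrow_tunnel T \<longleftrightarrow> (\<forall>n. finite (T n) \<and> card (T n) \<le> 2 ^ n)"

text \<open>\<open>p\<close> forces that for every \<open>n\<close>, the value of \<open>\<tau>\<close> at \<open>n\<close> belongs to \<open>T n\<close>.\<close>

definition forces_enclosed ::
  "'p set \<Rightarrow> ('p \<Rightarrow> 'p \<Rightarrow> bool) \<Rightarrow> 'p \<Rightarrow> 'p rel_name \<Rightarrow> (nat \<Rightarrow> nat set) \<Rightarrow> bool" where
  "forces_enclosed P le p \<tau> T \<longleftrightarrow>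
     (\<forall>n. dense_below P le p (\<lambda>r. \<exists>m\<in>T n. forces_val P le r \<tau> n m))"

text \<open>
  Every condition forces: if \<open>\<tau>\<close> is a point of the Baire space, then it is enclosed by a narrow
  tunnel of the ground model.
\<close>

definition sacks_property :: "'p set \<Rightarrow> ('p \<Rightarrow> 'p \<Rightarrow> bool) \<Rightarrow> bool" where
  "sacks_property P le \<longleftrightarrow>
     (\<forall>\<tau>. \<forall>p\<in>P. forces_function P le p \<tau> \<longrightarrow>
        dense_below P le p (\<lambda>q. \<exists>T. narrow_tunnel T \<and> forces_enclosed P le q \<tau> T))"

end

theory Submission
  imports Defs
begin

text \<open>
  Let \<open>p\<close> force that \<open>\<tau>\<close> is a point of the Baire space. Applying properness to a countable elementary
  submodel containing \<open>p\<close> and the dense sets of conditions deciding the values of \<open>\<tau>\<close> gives a positive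
  Borel set \<open>B \<subseteq> p\<close> on which \<open>\<tau>\<close> is represented by a Borel function \<open>f\<close>. Properness plays no further role:
  a dichotomy in the style of Kechris, Solecki and Todorcevic thins out \<open>B\<close>. Parametrise \<open>B\<close> by a
  closed subset of the Baire space on which \<open>f\<close> becomes continuous, and build a continuous map \<open>\<phi>\<close> from a
  product of finite sets into \<open>B\<close> such that, for densely many initial segments \<open>t\<close> and every hypergraph
  of the family, the points \<open>\<phi> (t, i, x)\<close> with \<open>i\<close> varying form an edge for each tail \<open>x\<close>. The image
  \<open>C\<close> of \<open>\<phi>\<close> is compact. It is positive: if it were covered by countably many Borel anticliques, one of their
  preimages would be comeager in some basic open set and hence contain all \<open>(t, i, x)\<close> for a suitable
  \<open>t\<close> and \<open>x\<close>. Since the construction has finitely many branches at each stage and their number does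
  not depend on \<open>f\<close>, the values of \<open>f\<close> can be decided so early along the construction that they
  lie in a narrow tunnel on \<open>C\<close>.
\<close>

section \<open>Continuous images of closed subsets of the Baire space\<close>

definition cyl :: "(nat \<Rightarrow> nat) \<Rightarrow> nat \<Rightarrow> (nat \<Rightarrow> nat) set" where
  "cyl x n = {y. \<forall>j<n. y j = x j}"

lemma cyl_self [simp]: "x \<in> cyl x n"
  by (simp add: cyl_def)

lemma cyl_antimono: "m \<le> n \<Longrightarrow> cyl x n \<subseteq> cyl x m"
  by (auto simp: cyl_def)

lemma open_coordinate: "open {z :: nat \<Rightarrow> nat. P (z n)}"
proof -
  have "open ((\<lambda>z :: nat \<Rightarrow> nat. z n) -` {k. P k})"
    by (intro open_vimage continuous_on_product_coordinates open_discrete)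
  then show ?thesis by (simp add: vimage_def)
qed

lemma closed_coordinate: "closed {z :: nat \<Rightarrow> nat. P (z n)}"
  using open_coordinate[of "\<lambda>k. \<not> P k" n] by (simp add: closed_def Collect_neg_eq)

lemma open_cyl: "open (cyl x n)"
proof -
  have "cyl x n = (\<Inter>j\<in>{..<n}. {y. y j = x j})" by (auto simp: cyl_def)
  then show ?thesis by (auto intro!: open_INT open_coordinate)
qed

lemma closed_cyl: "closed (cyl x n)"
proof -
  have "cyl x n = (\<Inter>j\<in>{..<n}. {y. y j = x j})" by (auto simp: cyl_def)
  then show ?thesis by (auto intro!: closed_INT closed_coordinate)
qed

lemma open_contains_cyl:
  assumes "open U" "x \<in> U"
  shows "\<exists>n. cyl x n \<subseteq> U"
proof -
  have "openin (product_topology (\<lambda>i::nat. euclidean :: nat topology) UNIV) U"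
    using assms(1) open_fun_def by blast
  from product_topology_open_contains_basis[OF this assms(2)]
  obtain X where X: "x \<in> (\<Pi>\<^sub>E i\<in>UNIV. X i)" "finite {i. X i \<noteq> UNIV}" "(\<Pi>\<^sub>E i\<in>UNIV. X i) \<subseteq> U"
    by auto
  from X(2) obtain n where n: "\<forall>i\<in>{i. X i \<noteq> UNIV}. i < n"
    using finite_nat_set_iff_bounded by blast
  have "y \<in> (\<Pi>\<^sub>E i\<in>UNIV. X i)" if "y \<in> cyl x n" for y
  proof -
    have "y i \<in> X i" for i
    proof (cases "X i = UNIV")
      case False
      then have "y i = x i" using n that by (auto simp: cyl_def)
      then show ?thesis using X(1) by auto
    qed auto
    then show ?thesis by auto
  qed
  then show ?thesis using X(3) by blast
qed

lemma closed_limit_cyl: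
  assumes "closed F" "\<And>n. \<exists>y\<in>F. y \<in> cyl x n"
  shows "x \<in> F"
proof (rule ccontr)
  assume "x \<notin> F"
  then obtain n where "cyl x n \<subseteq> - F"
    using open_contains_cyl[of "- F" x] assms(1) by auto
  then show False using assms(2)[of n] by blast
qed

lemma continuous_on_cylD:
  assumes "continuous_on F f" "x \<in> F" "open U" "f x \<in> U"
  shows "\<exists>n. \<forall>y\<in>F \<inter> cyl x n. f y \<in> U"
proof -
  from assms obtain A where A: "open A" "x \<in> A" "\<forall>y\<in>F. y \<in> A \<longrightarrow> f y \<in> U"
    unfolding continuous_on_topological by meson
  then obtain n where "cyl x n \<subseteq> A" using open_contains_cyl by blast
  then show ?thesis using A by blast
qed

lemma continuous_on_cylI:
  fixes f :: "(nat \<Rightarrow> nat) \<Rightarrow> 'b::topological_space"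
  assumes "\<And>x U. x \<in> F \<Longrightarrow> open U \<Longrightarrow> f x \<in> U \<Longrightarrow> \<exists>n. \<forall>y\<in>F \<inter> cyl x n. f y \<in> U"
  shows "continuous_on F f"
  unfolding continuous_on_topological
proof (intro ballI allI impI)
  fix x U assume "x \<in> F" "open U" "f x \<in> U"
  from assms[OF this] obtain n where "\<forall>y\<in>F \<inter> cyl x n. f y \<in> U" by blast
  then show "\<exists>A. open A \<and> x \<in> A \<and> (\<forall>y\<in>F. y \<in> A \<longrightarrow> f y \<in> U)"
    by (intro exI[of _ "cyl x n"]) (auto simp: open_cyl)
qed

lemma continuous_on_UNIV_cyl_iff:
  fixes f :: "(nat \<Rightarrow> nat) \<Rightarrow> nat \<Rightarrow> nat"
  assumes "\<And>x n. \<exists>r. \<forall>y\<in>cyl x r. f y n = f x n"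
  shows "continuous_on UNIV f"
proof (rule continuous_on_coordinatewise_then_product)
  fix n
  show "continuous_on UNIV (\<lambda>x. f x n)"
    using assms[of _ n] by (intro continuous_on_cylI) fastforce
qed

lemma closed_Collect_eq_on:
  fixes f g :: "'b::topological_space \<Rightarrow> 'c::topological_space"
  assumes "closed {p :: 'c \<times> 'c. fst p = snd p}"
    and "closed S" "continuous_on S f" "continuous_on S g"
  shows "closed {x \<in> S. f x = g x}"
  using continuous_closed_preimage[OF continuous_on_Pair[OF assms(3,4)] assms(2,1)]
  by (simp add: Int_def vimage_def)

lemma closed_diagonal_t2: "closed {p :: 'a::t2_space \<times> 'a. fst p = snd p}"
  by (intro closed_Collect_eq continuous_intros)

lemma closed_diagonal_baire: "closed {p :: (nat \<Rightarrow> nat) \<times> (nat \<Rightarrow> nat). fst p = snd p}"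
proof -
  have "closed {p :: (nat \<Rightarrow> nat) \<times> (nat \<Rightarrow> nat). fst p n = snd p n}" for n
    using continuous_on_product_then_coordinatewise[OF continuous_on_fst[OF continuous_on_id], of UNIV n]
      continuous_on_product_then_coordinatewise[OF continuous_on_snd[OF continuous_on_id], of UNIV n]
    by (intro closed_Collect_eq) simp_all
  then have "closed (\<Inter>n. {p :: (nat \<Rightarrow> nat) \<times> (nat \<Rightarrow> nat). fst p n = snd p n})"
    by blast
  moreover have "{p :: (nat \<Rightarrow> nat) \<times> (nat \<Rightarrow> nat). fst p = snd p} = (\<Inter>n. {p. fst p n = snd p n})"
    by (intro set_eqI) (simp only: fun_eq_iff mem_Collect_eq INT_iff UNIV_I ball_UNIV)
  ultimately show ?thesis by simp
qed

section \<open>Coding sequences of points, and closure properties of analytic sets\<close>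

definition sect :: "nat \<Rightarrow> (nat \<Rightarrow> nat) \<Rightarrow> nat \<Rightarrow> nat" where
  "sect i z = (\<lambda>j. z (prod_encode (i, j)))"

definition tuple :: "(nat \<Rightarrow> nat \<Rightarrow> nat) \<Rightarrow> nat \<Rightarrow> nat" where
  "tuple f q = case_prod f (prod_decode q)"

lemma sect_tuple [simp]: "sect i (tuple f) = f i"
  by (simp add: sect_def tuple_def)

lemma continuous_on_sect: "continuous_on S (sect i)"
  unfolding sect_def
  by (intro continuous_on_coordinatewise_then_product continuous_on_subset[OF continuous_on_product_coordinates] subset_UNIV)

lemma continuous_on_shift: "continuous_on S (\<lambda>(z :: nat \<Rightarrow> nat) j. z (Suc j))"
  by (intro continuous_on_coordinatewise_then_product continuous_on_subset[OF continuous_on_product_coordinates] subset_UNIV)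

text \<open>These are the analytic sets. Closed domains include the empty set and allow a
  parametrisation to be cut down by closed conditions.\<close>

definition suslin :: "'a::topological_space set \<Rightarrow> bool" where
  "suslin A \<longleftrightarrow> (\<exists>(F :: (nat \<Rightarrow> nat) set) f. closed F \<and> continuous_on F f \<and> f ` F = A)"

lemma suslin_image:
  assumes "suslin A" "continuous_on A f"
  shows "suslin (f ` A)"
proof -
  obtain F :: "(nat \<Rightarrow> nat) set" and g where F: "closed F" "continuous_on F g" "g ` F = A"
    using assms(1) unfolding suslin_def by blast
  have "continuous_on F (f \<circ> g)"
    using F assms(2) by (intro continuous_on_compose) auto
  then have "closed F \<and> continuous_on F (f \<circ> g) \<and> (f \<circ> g) ` F = f ` A"
    using F by auto
  then show ?thesis unfolding suslin_def by blast
qed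

text \<open>
  Besides closure under countable unions and intersections, this records the chosen index of the
  union over \<open>m\<close> in the coordinate \<open>e n\<close> of the parameter. Later it turns a Borel map
  into the Baire space into a continuous one on the parameter space. The closedness of the diagonal
  replaces the Hausdorff axiom because \<^typ>\<open>nat \<Rightarrow> nat\<close> is not an instance of \<open>t2_space\<close>.
\<close>

lemma suslin_INT_UN_witness:
  fixes D :: "nat \<Rightarrow> nat \<Rightarrow> 'a::topological_space set"
  assumes diagonal: "closed {p :: 'a \<times> 'a. fst p = snd p}" and "\<And>n m. suslin (D n m)"
  obtains F :: "(nat \<Rightarrow> nat) set" and \<psi> e where "closed F" "continuous_on F \<psi>" "\<psi> ` F = (\<Inter>n. \<Union>m. D n m)"
    "\<And>n z. z \<in> F \<Longrightarrow> \<psi> z \<in> D n (z (e n))"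
proof -
  from assms(2) obtain H f where H: "\<And>n m. closed (H n m :: (nat \<Rightarrow> nat) set)"
    and f: "\<And>n m. continuous_on (H n m) (f n m)" "\<And>n m. f n m ` H n m = D n m"
    unfolding suslin_def by metis
  define sh where "sh = (\<lambda>(z :: nat \<Rightarrow> nat) j. z (Suc j))"
  \<comment> \<open>A code for a point of \<open>\<Union>m. D n m\<close> starts with the index
    \<open>m\<close> and continues, after the shift, with a code for a point of
    \<open>D n m\<close>.\<close>
  define G where "G n = {z. sh z \<in> H n (z 0)}" for n
  define h where "h n z = f n (z 0) (sh z)" for n z
  have G: "closed (G n)" for n
  proof -
    have "closed (sh -` H n m)" for m
      unfolding sh_def by (intro closed_vimage H continuous_on_shift)
    moreover have "G n = (\<Inter>m. {z. z 0 \<noteq> m} \<union> sh -` H n m)"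
      by (auto simp: G_def)
    ultimately show ?thesis
      using closed_coordinate by (auto intro!: closed_INT closed_Un)
  qed
  have h: "continuous_on (G n) (h n)" for n
  proof (rule continuous_on_cylI)
    fix x U assume x: "x \<in> G n" "open U" "h n x \<in> U"
    then obtain r where r: "\<forall>y\<in>H n (x 0) \<inter> cyl (sh x) r. f n (x 0) y \<in> U"
      using continuous_on_cylD[OF f(1)] unfolding G_def h_def by blast
    have "h n y \<in> U" if "y \<in> G n" "y \<in> cyl x (Suc r)" for y
    proof -
      have "y 0 = x 0" "sh y \<in> cyl (sh x) r"
        using that(2) by (auto simp: cyl_def sh_def)
      then show ?thesis using r that(1) by (auto simp: G_def h_def)
    qed
    then show "\<exists>n'. \<forall>y\<in>G n \<inter> cyl x n'. h n y \<in> U" by blast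
  qed
  define S where "S = (\<Inter>n. sect n -` G n)"
  have S: "closed S"
    unfolding S_def by (intro closed_INT ballI closed_vimage G continuous_on_sect)
  have hS: "continuous_on S (\<lambda>z. h n (sect n z))" for n
    by (rule continuous_on_compose2[OF h continuous_on_sect]) (auto simp: S_def)
  \<comment> \<open>The codes in all sections must yield the same point. This closed condition turns
    a product of parametrisations into one of the intersection.\<close>
  define F where "F = (\<Inter>n. {z \<in> S. h n (sect n z) = h 0 (sect 0 z)})"
  define \<psi> where "\<psi> z = h 0 (sect 0 z)" for z
  have FS: "F \<subseteq> S" by (auto simp: F_def)
  have eq: "\<psi> z = h n (sect n z)" if "z \<in> F" for z n
    using that unfolding F_def \<psi>_def by (metis (mono_tags, lifting) INT_E UNIV_I mem_Collect_eq)
  have mem: "\<psi> z \<in> D n (z (prod_encode (n, 0)))" if "z \<in> F" for z n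
  proof -
    have "sect n z \<in> G n" using that FS by (auto simp: S_def)
    then have "sh (sect n z) \<in> H n (sect n z 0)" by (simp add: G_def)
    then have "h n (sect n z) \<in> D n (sect n z 0)" using f(2) by (auto simp: h_def)
    then show ?thesis using eq[OF that] by (simp add: sect_def)
  qed
  show thesis
  proof
    show "closed F"
      unfolding F_def by (intro closed_INT ballI closed_Collect_eq_on diagonal S hS)
    show "continuous_on F \<psi>"
      unfolding \<psi>_def by (rule continuous_on_subset[OF hS FS])
    show "\<psi> ` F = (\<Inter>n. \<Union>m. D n m)"
    proof
      show "\<psi> ` F \<subseteq> (\<Inter>n. \<Union>m. D n m)" using mem by blast
      show "(\<Inter>n. \<Union>m. D n m) \<subseteq> \<psi> ` F"
      proof
        fix x assume "x \<in> (\<Inter>n. \<Union>m. D n m)"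
        then have "\<forall>n. \<exists>m y. y \<in> H n m \<and> f n m y = x"
          using f(2) by (metis INT_E UN_E UNIV_I imageE)
        then obtain m y where my: "\<And>n. y n \<in> H n (m n)" "\<And>n. f n (m n) (y n) = x"
          by metis
        define z where "z = tuple (\<lambda>n. case_nat (m n) (y n))"
        have sz: "sh (sect n z) = y n" "sect n z 0 = m n" for n
          by (auto simp: z_def sh_def)
        then have "z \<in> S" "h n (sect n z) = x" for n
          using my by (auto simp: S_def G_def h_def)
        then show "x \<in> \<psi> ` F" by (auto simp: F_def \<psi>_def intro!: image_eqI[of _ _ z])
      qed
    qed
    show "\<And>n z. z \<in> F \<Longrightarrow> \<psi> z \<in> D n (z (prod_encode (n, 0)))" using mem .
  qed
qed

lemma suslin_UN:
  fixes A :: "nat \<Rightarrow> 'a::topological_space set"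
  assumes "closed {p :: 'a \<times> 'a. fst p = snd p}" and "\<And>n. suslin (A n)"
  shows "suslin (\<Union>n. A n)"
proof (rule suslin_INT_UN_witness[of "\<lambda>n m. A m"])
  fix F and \<psi> :: "(nat \<Rightarrow> nat) \<Rightarrow> 'a" assume "closed F" "continuous_on F \<psi>" "\<psi> ` F = (\<Inter>n::nat. \<Union>m. A m)"
  then show ?thesis unfolding suslin_def by (intro exI[of _ F] exI[of _ \<psi>]) simp
qed (use assms in auto)

lemma suslin_INT:
  fixes A :: "nat \<Rightarrow> 'a::topological_space set"
  assumes "closed {p :: 'a \<times> 'a. fst p = snd p}" and "\<And>n. suslin (A n)"
  shows "suslin (\<Inter>n. A n)"
proof (rule suslin_INT_UN_witness[of "\<lambda>n m. A n"])
  fix F and \<psi> :: "(nat \<Rightarrow> nat) \<Rightarrow> 'a" assume "closed F" "continuous_on F \<psi>" "\<psi> ` F = (\<Inter>n. \<Union>m::nat. A n)"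
  then show ?thesis unfolding suslin_def by (intro exI[of _ F] exI[of _ \<psi>]) simp
qed (use assms in auto)

text \<open>The induction over Borel sets carries the complement along: a countable union of sets
  goes with a countable intersection of their complements.\<close>

lemma suslin_borelI:
  fixes A :: "'a::topological_space set"
  assumes diagonal: "closed {p :: 'a \<times> 'a. fst p = snd p}" and "A \<in> sets borel" and "\<And>U::'a set. open U \<Longrightarrow> suslin U"
    and "\<And>U::'a set. open U \<Longrightarrow> suslin (- U)"
  shows "suslin A"
proof -
  have "A \<in> sigma_sets UNIV {S. open S}" using assms(2) by (simp add: sets_borel)
  then have "suslin A \<and> suslin (- A)"
  proof induction
    case (Union a)
    then show ?case using suslin_UN[OF diagonal, of a] suslin_INT[OF diagonal, of "\<lambda>n. - a n"] by simp
  next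
    case Empty
    then show ?case using assms(3,4)[of "{}"] by simp
  qed (use assms in \<open>simp_all add: Compl_eq_Diff_UNIV[symmetric]\<close>)
  then show ?thesis by simp
qed

section \<open>Borel sets of the Baire space and of Polish spaces are analytic\<close>

lemma suslin_closed_baire: "closed (F :: (nat \<Rightarrow> nat) set) \<Longrightarrow> suslin F"
  unfolding suslin_def by (intro exI[of _ F] exI[of _ id]) simp

lemma suslin_borel_baire:
  fixes A :: "(nat \<Rightarrow> nat) set"
  assumes "A \<in> sets borel"
  shows "suslin A"
proof (rule suslin_borelI[OF closed_diagonal_baire assms])
  fix U :: "(nat \<Rightarrow> nat) set" assume U: "open U"
  show "suslin (- U)" using U by (intro suslin_closed_baire closed_Compl)
  define c where "c xs = {z :: nat \<Rightarrow> nat. map z [0..<length xs] = xs}" for xs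
  have cyl: "c (map x [0..<n]) = cyl x n" for x n
    by (auto simp: c_def cyl_def)
  have sus: "suslin (if c xs \<subseteq> U then c xs else {})" for xs
  proof -
    have "closed (c xs)"
    proof (cases "c xs = {}")
      case False
      then obtain x where "map x [0..<length xs] = xs" unfolding c_def by blast
      then have "c xs = cyl x (length xs)" using cyl[of x "length xs"] by simp
      then show ?thesis using closed_cyl by simp
    qed simp
    then show ?thesis using suslin_closed_baire[of "c xs"] suslin_closed_baire[of "{}"] by simp
  qed
  have "U = (\<Union>n. if c (from_nat n) \<subseteq> U then c (from_nat n) else {})"
  proof
    show "U \<subseteq> (\<Union>n. if c (from_nat n) \<subseteq> U then c (from_nat n) else {})"
    proof
      fix x assume "x \<in> U"
      then obtain n where "cyl x n \<subseteq> U" using open_contains_cyl U by blast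
      then have "x \<in> (if c (from_nat (to_nat (map x [0..<n]))) \<subseteq> U
          then c (from_nat (to_nat (map x [0..<n]))) else {})"
        by (simp add: cyl)
      then show "x \<in> (\<Union>n. if c (from_nat n) \<subseteq> U then c (from_nat n) else {})" by blast
    qed
  qed (auto split: if_splits)
  moreover have "suslin (\<Union>n. if c (from_nat n) \<subseteq> U then c (from_nat n) else {})"
    by (intro suslin_UN closed_diagonal_baire sus)
  ultimately show "suslin U" by simp
qed

text \<open>Points are coded by fast Cauchy sequences in a countable dense set. The distance bounds
  are closed conditions on the code, and the value \<open>z N\<close> alone determines the limit up
  to \<open>(1/2)^N\<close>, so taking limits is continuous.\<close>

lemma suslin_closed_polish:
  fixes C :: "'a::polish_space set"
  assumes "closed C"
  shows "suslin C"
proof -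
  obtain D :: "'a set" where D: "countable D" "\<And>X. open X \<Longrightarrow> X \<noteq> {} \<Longrightarrow> \<exists>d\<in>D. d \<in> X"
    by (rule countable_dense_setE) blast
  define d where "d = from_nat_into D"
  have "D \<noteq> {}" using D(2)[of UNIV] by auto
  then have d: "\<exists>n. dist (d n) x < e" if "e > 0" for x e
  proof -
    have "\<exists>y\<in>D. y \<in> ball x e" using that D(2)[of "ball x e"] by (metis ball_eq_empty linorder_not_less open_ball)
    then show ?thesis unfolding d_def
      by (metis D(1) dist_commute from_nat_into_surj mem_ball)
  qed
  define E where "E = {z :: nat \<Rightarrow> nat. \<forall>n m. dist (d (z n)) (d (z m)) \<le> (1/2)^n + (1/2)^m}"
  define f where "f z = lim (\<lambda>n. d (z n))" for z
  have "closed E"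
  proof -
    have "closed {z :: nat \<Rightarrow> nat. P (z n) (z m)}" for P n m
    proof -
      have "{z :: nat \<Rightarrow> nat. P (z n) (z m)} = (\<Inter>a. {z. z n \<noteq> a} \<union> {z. P a (z m)})" by auto
      also have "closed \<dots>"
        using closed_coordinate[of "\<lambda>k. k \<noteq> _" n] by (intro closed_INT ballI closed_Un closed_coordinate)
      finally show ?thesis .
    qed
    then have "closed (\<Inter>n m. {z :: nat \<Rightarrow> nat. dist (d (z n)) (d (z m)) \<le> (1/2)^n + (1/2)^m})"
      by (intro closed_INT ballI)
    moreover have "(\<Inter>n m. {z :: nat \<Rightarrow> nat. dist (d (z n)) (d (z m)) \<le> (1/2)^n + (1/2)^m}) = E"
      by (auto simp: E_def)
    ultimately show ?thesis by simp
  qed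
  have lim: "(\<lambda>n. d (z n)) \<longlonglongrightarrow> f z" if "z \<in> E" for z
  proof -
    have "Cauchy (\<lambda>n. d (z n))"
    proof (rule metric_CauchyI)
      fix e :: real assume "e > 0"
      then obtain N where N: "(1/2)^N < e/2"
        using real_arch_pow_inv[of "e/2" "1/2"] by auto
      have "dist (d (z m)) (d (z n)) < e" if "m \<ge> N" "n \<ge> N" for m n
      proof -
        have "dist (d (z m)) (d (z n)) \<le> (1/2)^m + (1/2)^n" using \<open>z \<in> E\<close> by (simp add: E_def)
        also have "\<dots> \<le> (1/2)^N + (1/2)^N"
          using that by (intro add_mono power_decreasing) auto
        finally show ?thesis using N by simp
      qed
      then show "\<exists>M. \<forall>m\<ge>M. \<forall>n\<ge>M. dist (d (z m)) (d (z n)) < e" by blast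
    qed
    then show ?thesis
      unfolding f_def using Cauchy_convergent convergent_LIMSEQ_iff by blast
  qed
  have close: "dist (d (z n)) (f z) \<le> (1/2)^n" if "z \<in> E" for z n
  proof (rule LIMSEQ_le)
    show "(\<lambda>m. dist (d (z n)) (d (z m))) \<longlonglongrightarrow> dist (d (z n)) (f z)"
      by (intro tendsto_intros lim that)
    have "(\<lambda>m. (1/2)^n + (1/2)^m :: real) \<longlonglongrightarrow> (1/2)^n + 0"
      by (intro tendsto_intros LIMSEQ_power_zero) auto
    then show "(\<lambda>m. (1/2)^n + (1/2)^m :: real) \<longlonglongrightarrow> (1/2)^n" by simp
    show "\<exists>N. \<forall>m\<ge>N. dist (d (z n)) (d (z m)) \<le> (1/2)^n + (1/2)^m"
      using that by (auto simp: E_def)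
  qed
  have cont: "continuous_on E f"
  proof (rule continuous_on_cylI)
    fix x U assume x: "x \<in> E" "open U" "f x \<in> U"
    then obtain e where e: "e > 0" "ball (f x) e \<subseteq> U" by (meson openE)
    then obtain N where N: "(1/2)^N < e/2"
      using real_arch_pow_inv[of "e/2" "1/2"] by auto
    have "f y \<in> U" if "y \<in> E \<inter> cyl x (Suc N)" for y
    proof -
      have "dist (d (x N)) (f x) \<le> (1/2)^N" "dist (d (y N)) (f y) \<le> (1/2)^N"
        using close[of x N] close[of y N] x that by simp_all
      moreover have "y N = x N"
        using that by (simp add: cyl_def)
      moreover have "dist (f x) (f y) \<le> dist (d (x N)) (f x) + dist (d (x N)) (f y)"
        by (simp add: dist_triangle3)
      ultimately have "dist (f x) (f y) < e" using N by simp
      then show ?thesis using e(2) by auto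
    qed
    then show "\<exists>n. \<forall>y\<in>E \<inter> cyl x n. f y \<in> U" by blast
  qed
  have surj: "\<exists>z\<in>E. f z = x" for x
  proof -
    have "\<exists>k. dist (d k) x < (1/2)^n" for n
      by (intro d) simp
    then obtain z where z: "\<And>n. dist (d (z n)) x < (1/2)^n"
      by metis
    have "z \<in> E"
      unfolding E_def
    proof (clarify)
      fix n m
      have "dist (d (z n)) (d (z m)) \<le> dist (d (z n)) x + dist (d (z m)) x" by (rule dist_triangle2)
      then show "dist (d (z n)) (d (z m)) \<le> (1/2)^n + (1/2)^m" using z[of n] z[of m] by simp
    qed
    moreover have "(\<lambda>n. d (z n)) \<longlonglongrightarrow> x"
    proof (rule metric_LIMSEQ_I)
      fix e :: real assume "e > 0"
      then obtain N where N: "(1/2)^N < e"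
        using real_arch_pow_inv[of "e" "1/2"] by auto
      have "dist (d (z n)) x < e" if "n \<ge> N" for n
      proof -
        have "(1/2 :: real)^n \<le> (1/2)^N" using that by (intro power_decreasing) auto
        then show ?thesis using z[of n] N by linarith
      qed
      then show "\<exists>N. \<forall>n\<ge>N. dist (d (z n)) x < e" by blast
    qed
    ultimately show ?thesis using lim LIMSEQ_unique by blast
  qed
  have "closed (E \<inter> f -` C)" using continuous_closed_preimage[OF cont \<open>closed E\<close> assms] .
  moreover have "continuous_on (E \<inter> f -` C) f" using cont continuous_on_subset by blast
  moreover have "f ` (E \<inter> f -` C) = C"
  proof
    show "C \<subseteq> f ` (E \<inter> f -` C)"
    proof
      fix x assume "x \<in> C"
      with surj[of x] show "x \<in> f ` (E \<inter> f -` C)" by blast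
    qed
  qed blast
  ultimately show ?thesis unfolding suslin_def by blast
qed

lemma suslin_borel_polish:
  fixes A :: "'a::polish_space set"
  assumes "A \<in> sets borel"
  shows "suslin A"
proof (rule suslin_borelI[OF closed_diagonal_t2 assms])
  fix U :: "'a set" assume U: "open U"
  show "suslin (- U)" using U by (intro suslin_closed_polish closed_Compl)
  show "suslin U"
  \<comment> \<open>The second case exhausts \<open>U\<close> by closed sets of points at positive
    distance from \<open>- U\<close>. For \<open>U = UNIV\<close> this fails because
    \<open>infdist\<close> to the empty set is 0.\<close>
  proof (cases "U = UNIV")
    case True
    then show ?thesis using suslin_closed_polish by auto
  next
    case False
    define c where "c n = {x. infdist x (- U) \<ge> inverse (real (Suc n))}" for n
    have "closed (c n)" for n
      unfolding c_def by (intro closed_Collect_le continuous_intros)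
    moreover have "U = (\<Union>n. c n)"
    proof -
      have "x \<in> U \<longleftrightarrow> infdist x (- U) > 0" for x
        using U False in_closed_iff_infdist_zero[of "- U" x] infdist_nonneg[of x "- U"]
        by (auto simp: less_le)
      moreover have "0 < e \<longleftrightarrow> (\<exists>n. inverse (real (Suc n)) \<le> e)" for e
        using reals_Archimedean less_imp_le less_le_trans[of 0 "inverse (real (Suc _))" e]
        by (metis inverse_positive_iff_positive of_nat_0_less_iff zero_less_Suc)
      ultimately show ?thesis
        unfolding c_def by blast
    qed
    ultimately show ?thesis using suslin_UN[OF closed_diagonal_t2, of c] suslin_closed_polish[of "c _"] by metis
  qed
qed

section \<open>Separation of an analytic anticlique by a Borel one\<close>

lemma branch_exists:
  fixes P :: "(nat \<Rightarrow> nat) \<Rightarrow> nat \<Rightarrow> bool"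
  assumes "P z0 0" and step: "\<And>z n. P z n \<Longrightarrow> \<exists>j. P (z(n := j)) (Suc n)"
    and local: "\<And>y z n. P y n \<Longrightarrow> z \<in> cyl y n \<Longrightarrow> P z n"
  shows "\<exists>z. \<forall>n. P z n"
proof -
  \<comment> \<open>By \<open>local\<close>, the pair \<open>(z, n)\<close> stands for the finite
    sequence of the first \<open>n\<close> values of \<open>z\<close>. Passing from \<open>n\<close>
    to \<open>Suc n\<close> changes only value \<open>n\<close>, so the sequences \<open>f n\<close>
    converge.\<close>
  have "\<exists>f. \<forall>n. P (f n) n \<and> (\<exists>j. f (Suc n) = (f n)(n := j))"
  proof (rule dependent_nat_choice[where P = "\<lambda>n z. P z n" and Q = "\<lambda>n z z'. \<exists>j. z' = z(n := j)"])
    show "\<exists>z. P z 0" using assms(1) by blast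
    show "\<exists>z'. P z' (Suc n) \<and> (\<exists>j. z' = z(n := j))" if "P z n" for z n
    proof -
      obtain j where "P (z(n := j)) (Suc n)" using step[OF \<open>P z n\<close>] by (rule exE)
      then show ?thesis by (intro exI[of _ "z(n := j)"] conjI exI[of _ j] refl)
    qed
  qed
  then obtain f where f: "\<And>n. P (f n) n" "\<And>n. \<exists>j. f (Suc n) = (f n)(n := j)"
    by (auto simp del: fun_upd_apply)
  have stable: "f m i = f (Suc i) i" if "i < m" for m i
    using that
  proof (induction m)
    case (Suc m)
    then show ?case using f(2)[of m] by (cases "i = m") auto
  qed simp
  define z where "z i = f (Suc i) i" for i
  have "z \<in> cyl (f n) n" for n
    unfolding cyl_def z_def by (auto intro: stable[symmetric])
  then show ?thesis using local f(1) by metis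
qed

lemma prod_encode_bounded: "\<exists>q. \<forall>i\<le>k. \<forall>j<n. prod_encode (i, j) < q"
proof -
  have "finite (prod_encode ` ({..k} \<times> {..<n}))" by simp
  then obtain q where "\<forall>m\<in>prod_encode ` ({..k} \<times> {..<n}). m < q"
    by (auto simp: finite_nat_set_iff_bounded)
  then show ?thesis by auto
qed

text \<open>
  Lusin's separation argument in several dimensions. The sequence \<open>\<zeta>\<close> codes, by pairing,
  \<open>k\<close> points of the parameter space of \<open>A\<close> and, as coordinate \<open>k\<close>, a parameter of an edge; one
  value of one coordinate is fixed at a time.
\<close>

lemma suslin_anticlique_separation:
  fixes g :: "nat \<Rightarrow> (nat \<Rightarrow> nat) \<Rightarrow> 'a::t2_space"
  assumes g: "\<And>i. continuous_on UNIV (g i)" and "suslin A" and anti: "\<nexists>w. \<forall>i<k. g i w \<in> A"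
  obtains B where "B \<in> sets borel" "A \<subseteq> B" "\<nexists>w. \<forall>i<k. g i w \<in> B"
proof -
  obtain F :: "(nat \<Rightarrow> nat) set" and \<psi> where F: "closed F" "continuous_on F \<psi>" "\<psi> ` F = A"
    using assms(2) unfolding suslin_def by blast
  have "k > 0" using anti by (cases k) auto
  \<comment> \<open>\<open>Z \<zeta> q i\<close> consists of the points compatible with what the
    first \<open>q\<close> values of \<open>\<zeta>\<close> prescribe for coordinate
    \<open>i\<close>.\<close>
  define Z where "Z \<zeta> q i = {y. \<forall>n. prod_encode (i, n) < q \<longrightarrow> y n = \<zeta> (prod_encode (i, n))}"
    for \<zeta> :: "nat \<Rightarrow> nat" and q i
  define good where "good \<zeta> q \<longleftrightarrow> (\<exists>Bs. (\<forall>i<k. Bs i \<in> sets borel \<and> \<psi> ` (F \<inter> Z \<zeta> q i) \<subseteq> Bs i) \<and>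
    \<not> (\<exists>w\<in>Z \<zeta> q k. \<forall>i<k. g i w \<in> Bs i))" for \<zeta> q
  have step: "good \<zeta> q" if "\<And>j. good (\<zeta>(q := j)) (Suc q)" for \<zeta> q
  proof -
    obtain i0 n0 where q: "q = prod_encode (i0, n0)"
      by (metis prod_decode_inverse surj_pair)
    have Z: "Z (\<zeta>(q := j)) (Suc q) i = (if i = i0 then Z \<zeta> q i \<inter> {y. y n0 = j} else Z \<zeta> q i)" for i j
      unfolding Z_def q by (auto simp: less_Suc_eq)
    have "\<forall>j. \<exists>Bs. (\<forall>i<k. Bs i \<in> sets borel \<and> \<psi> ` (F \<inter> Z (\<zeta>(q := j)) (Suc q) i) \<subseteq> Bs i) \<and>
      \<not> (\<exists>w\<in>Z (\<zeta>(q := j)) (Suc q) k. \<forall>i<k. g i w \<in> Bs i)"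
      using that unfolding good_def by blast
    then obtain Bs where borel: "\<And>j i. i < k \<Longrightarrow> Bs j i \<in> sets borel"
      and sub: "\<And>j i. i < k \<Longrightarrow> \<psi> ` (F \<inter> Z (\<zeta>(q := j)) (Suc q) i) \<subseteq> Bs j i"
      and disj: "\<And>j w. w \<in> Z (\<zeta>(q := j)) (Suc q) k \<Longrightarrow> \<exists>i<k. g i w \<notin> Bs j i"
      by metis
    \<comment> \<open>Fixing one more value splits only coordinate \<open>i0\<close>: there the sets
      for all values \<open>j\<close> are united. The other coordinates lie in every
      \<open>Bs j i\<close>, hence in the intersection.\<close>
    define B where "B i = (if i = i0 then (\<Union>j. Bs j i) else (\<Inter>j. Bs j i))" for i
    have "B i \<in> sets borel" if "i < k" for i
      using borel[OF that] unfolding B_def by auto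
    moreover have "\<psi> ` (F \<inter> Z \<zeta> q i) \<subseteq> B i" if i: "i < k" for i
    proof
      fix x assume "x \<in> \<psi> ` (F \<inter> Z \<zeta> q i)"
      then obtain y where y: "y \<in> F" "y \<in> Z \<zeta> q i" "x = \<psi> y" by blast
      show "x \<in> B i"
      proof (cases "i = i0")
        case True
        then have "x \<in> Bs (y n0) i" using sub[OF i, of "y n0"] y Z[of "y n0" i] by auto
        then show ?thesis using True by (auto simp: B_def)
      next
        case False
        then have "x \<in> Bs j i" for j using sub[OF i, of j] y Z[of j i] by auto
        then show ?thesis using False by (auto simp: B_def)
      qed
    qed
    moreover have "\<exists>i<k. g i w \<notin> B i" if w: "w \<in> Z \<zeta> q k" for w
    proof (rule ccontr)
      assume "\<not> (\<exists>i<k. g i w \<notin> B i)"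
      then have wB: "\<And>i. i < k \<Longrightarrow> g i w \<in> B i" by blast
      \<comment> \<open>One value \<open>j\<close> has to refute \<open>w\<close>. It is read off
        \<open>w\<close> if the edge parameter was split, and taken from the union if one of the
        points was.\<close>
      have "\<exists>j. (k = i0 \<longrightarrow> w n0 = j) \<and> (i0 < k \<longrightarrow> g i0 w \<in> Bs j i0)"
        using wB[of i0] by (cases "k = i0") (auto simp: B_def)
      then obtain j where j: "k = i0 \<longrightarrow> w n0 = j" "i0 < k \<longrightarrow> g i0 w \<in> Bs j i0" by blast
      have "w \<in> Z (\<zeta>(q := j)) (Suc q) k" using w j Z[of j k] by auto
      then obtain i where "i < k" "g i w \<notin> Bs j i" using disj by blast
      then show False using wB[of i] j by (auto simp: B_def split: if_splits)
    qed
    ultimately show ?thesis unfolding good_def by (intro exI[of _ B]) blast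
  qed
  have "good (\<lambda>_. 0) 0"
  proof (rule ccontr)
    assume bad: "\<not> good (\<lambda>_. 0) 0"
    have "\<exists>\<zeta>. \<forall>q. \<not> good \<zeta> q"
    proof (rule branch_exists[where P = "\<lambda>\<zeta> q. \<not> good \<zeta> q", OF bad])
      fix \<zeta> q assume "\<not> good \<zeta> q"
      then show "\<exists>j. \<not> good (\<zeta>(q := j)) (Suc q)" using step by blast
    next
      fix \<zeta> \<zeta>' q assume "\<not> good \<zeta> q" "\<zeta>' \<in> cyl \<zeta> q"
      moreover from this(2) have "Z \<zeta>' q = Z \<zeta> q"
        by (auto simp: Z_def cyl_def fun_eq_iff)
      ultimately show "\<not> good \<zeta>' q" by (simp add: good_def)
    qed
    then obtain \<zeta> where \<zeta>: "\<And>q. \<not> good \<zeta> q" by blast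
    define y where "y i = sect i \<zeta>" for i
    have Zcyl: "\<exists>q. \<forall>i\<le>k. Z \<zeta> q i \<subseteq> cyl (y i) n" for n
    proof -
      obtain q where "\<forall>i\<le>k. \<forall>j<n. prod_encode (i, j) < q" using prod_encode_bounded by blast
      then show ?thesis by (intro exI[of _ q]) (auto simp: Z_def cyl_def y_def sect_def)
    qed
    have yF: "y i \<in> F" if i: "i < k" for i
    proof (rule closed_limit_cyl[OF F(1)], rule ccontr)
      fix n assume n: "\<not> (\<exists>z\<in>F. z \<in> cyl (y i) n)"
      obtain q where q: "\<forall>i\<le>k. Z \<zeta> q i \<subseteq> cyl (y i) n" using Zcyl by blast
      have "F \<inter> Z \<zeta> q i = {}" using n q less_imp_le[OF i] by blast
      then have "good \<zeta> q"
        unfolding good_def using i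
        by (intro exI[of _ "(\<lambda>_. UNIV)(i := {})"]) (auto intro!: exI[of _ i])
      then show False using \<zeta> by blast
    qed
    then have "\<And>i. i < k \<Longrightarrow> \<psi> (y i) \<in> A" using F(3) by blast
    \<comment> \<open>The limit points lie in \<open>A\<close> and so cannot be the entries of the
      edge with parameter \<open>y k\<close>. Disjoint neighbourhoods of two differing entries then
      separate at a finite stage of the bad branch.\<close>
    then obtain i where i: "i < k" "g i (y k) \<noteq> \<psi> (y i)" using anti by metis
    obtain U V where UV: "open U" "open V" "\<psi> (y i) \<in> U" "g i (y k) \<in> V" "U \<inter> V = {}"
      using hausdorff[OF i(2)] by blast
    obtain a where a: "\<forall>z\<in>F \<inter> cyl (y i) a. \<psi> z \<in> U"
      using continuous_on_cylD[OF F(2) yF[OF i(1)] UV(1,3)] by (rule exE)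
    obtain b where b: "\<forall>z\<in>UNIV \<inter> cyl (y k) b. g i z \<in> V"
      using continuous_on_cylD[of UNIV "g i" "y k" V, OF g UNIV_I UV(2,4)] by (rule exE)
    obtain q where q: "\<forall>i\<le>k. Z \<zeta> q i \<subseteq> cyl (y i) (max a b)" using Zcyl by blast
    have Zab: "Z \<zeta> q i \<subseteq> cyl (y i) a" "Z \<zeta> q k \<subseteq> cyl (y k) b"
      using q less_imp_le[OF i(1)] cyl_antimono[of a "max a b" "y i"] cyl_antimono[of b "max a b" "y k"]
      by auto
    have "\<psi> ` (F \<inter> Z \<zeta> q i) \<subseteq> U" using a Zab(1) by blast
    moreover have "\<forall>w\<in>Z \<zeta> q k. g i w \<notin> U" using b Zab(2) UV(5) by blast
    ultimately have "good \<zeta> q"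
      unfolding good_def using i(1) UV(1)
      by (intro exI[of _ "(\<lambda>_. UNIV)(i := U)"]) (auto intro!: exI[of _ i])
    then show False using \<zeta> by blast
  qed
  then obtain Bs where Bs: "\<And>i. i < k \<Longrightarrow> Bs i \<in> sets borel" "\<And>i. i < k \<Longrightarrow> A \<subseteq> Bs i"
    "\<nexists>w. \<forall>i<k. g i w \<in> Bs i"
    unfolding good_def using F(3) by (auto simp: Z_def)
  show thesis
  proof
    show "(\<Inter>i\<in>{..<k}. Bs i) \<in> sets borel"
      using Bs(1) \<open>k > 0\<close> by (intro sets.finite_INT) auto
    show "A \<subseteq> (\<Inter>i\<in>{..<k}. Bs i)" using Bs(2) by blast
    show "\<nexists>w. \<forall>i<k. g i w \<in> (\<Inter>i\<in>{..<k}. Bs i)" using Bs(3) by blast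
  qed
qed

section \<open>Baire category in the Baire space\<close>

definition dense_open :: "(nat \<Rightarrow> nat) set \<Rightarrow> bool" where
  "dense_open D \<longleftrightarrow> open D \<and> (\<forall>x n. D \<inter> cyl x n \<noteq> {})"

lemma baire_category:
  assumes "\<And>n::nat. dense_open (D n)"
  shows "\<exists>y. \<forall>n. y \<in> D n"
proof -
  \<comment> \<open>A stage is a cylinder given by a point and a length. Length at least
    \<open>n\<close> at stage \<open>n\<close> makes the nested cylinders determine a point.\<close>
  define P where "P n p \<longleftrightarrow> n \<le> snd p" for n and p :: "(nat \<Rightarrow> nat) \<times> nat"
  define Q where "Q n p p' \<longleftrightarrow> fst p' \<in> cyl (fst p) (snd p) \<and> snd p \<le> snd p' \<and> cyl (fst p') (snd p') \<subseteq> D n"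
    for n and p p' :: "(nat \<Rightarrow> nat) \<times> nat"
  have "\<exists>f. \<forall>n. P n (f n) \<and> Q n (f n) (f (Suc n))"
  proof (rule dependent_nat_choice[where P = P and Q = Q])
    show "\<exists>p. P 0 p" by (simp add: P_def)
    show "\<exists>p'. P (Suc n) p' \<and> Q n p p'" if "P n p" for n p
    proof -
      obtain z where z: "z \<in> D n" "z \<in> cyl (fst p) (snd p)"
        using assms[of n] unfolding dense_open_def by blast
      then obtain r where r: "cyl z r \<subseteq> D n"
        using assms[of n] open_contains_cyl[of "D n" z] unfolding dense_open_def by blast
      have "cyl z (Suc r + snd p) \<subseteq> D n"
        using r cyl_antimono[of r "Suc r + snd p" z] by simp
      then have "Q n p (z, Suc r + snd p)" using z by (simp add: Q_def)
      moreover have "P (Suc n) (z, Suc r + snd p)" using that by (simp add: P_def)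
      ultimately show ?thesis by blast
    qed
  qed
  then obtain f where f: "\<And>n. P n (f n)" "\<And>n. Q n (f n) (f (Suc n))" by metis
  define z r where "z n = fst (f n)" and "r n = snd (f n)" for n
  have r: "n \<le> r n" for n using f(1)[of n] by (simp add: P_def r_def)
  have Q: "z (Suc n) \<in> cyl (z n) (r n)" "r n \<le> r (Suc n)" "cyl (z (Suc n)) (r (Suc n)) \<subseteq> D n" for n
    using f(2)[of n] by (simp_all add: Q_def z_def r_def)
  have mono: "z m \<in> cyl (z n) (r n) \<and> r n \<le> r m" if "n \<le> m" for m n
    using that
  proof (induction m rule: dec_induct)
    case (step m)
    then show ?case using Q(1,2)[of m] by (auto simp: cyl_def)
  qed simp
  define y where "y i = z (Suc i) i" for i
  have "y \<in> cyl (z n) (r n)" for n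
    unfolding cyl_def
  proof (clarify)
    fix i assume "i < r n"
    have "z (max n (Suc i)) i = z n i" using mono[of n "max n (Suc i)"] \<open>i < r n\<close> by (simp add: cyl_def)
    moreover have "z (max n (Suc i)) i = z (Suc i) i"
      using mono[of "Suc i" "max n (Suc i)"] r[of "Suc i"] by (simp add: cyl_def)
    ultimately show "y i = z n i" by (simp add: y_def)
  qed
  then show ?thesis using Q(3) by blast
qed

text \<open>The comeager set is kept as a sequence of dense open sets. For a complement, the
  boundary of \<open>U\<close> is removed by adding the dense open set
  \<open>U \<union> interior (- U)\<close>; for a union, the sequences are merged by
  pairing.\<close>

lemma borel_baire_property:
  fixes A :: "(nat \<Rightarrow> nat) set"
  assumes "A \<in> sets borel"
  shows "\<exists>U D. open U \<and> (\<forall>n::nat. dense_open (D n)) \<and> (\<forall>x. (\<forall>n. x \<in> D n) \<longrightarrow> (x \<in> A \<longleftrightarrow> x \<in> U))"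
proof -
  have UNIV: "dense_open UNIV" by (auto simp: dense_open_def cyl_def)
  have "A \<in> sigma_sets UNIV {S. open S}" using assms by (simp add: sets_borel)
  then show ?thesis
  proof induction
    case (Basic a)
    then show ?case using UNIV by (intro exI[of _ a] exI[of _ "\<lambda>_. UNIV"]) simp
  next
    case Empty
    then show ?case using UNIV by (intro exI[of _ "{}"] exI[of _ "\<lambda>_. UNIV"]) simp
  next
    case (Compl a)
    then obtain U D where U: "open U" and D: "\<And>n::nat. dense_open (D n)"
      and eq: "\<And>x. (\<forall>n. x \<in> D n) \<Longrightarrow> (x \<in> a \<longleftrightarrow> x \<in> U)" by metis
    define E where "E = (case_nat (U \<union> interior (- U)) D :: nat \<Rightarrow> (nat \<Rightarrow> nat) set)"
    have "dense_open (U \<union> interior (- U))"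
      unfolding dense_open_def
    proof (intro conjI allI)
      fix x n
      show "(U \<union> interior (- U)) \<inter> cyl x n \<noteq> {}"
      proof (cases "cyl x n \<subseteq> - U")
        case True
        then have "x \<in> interior (- U)" by (intro interiorI[OF open_cyl cyl_self])
        then show ?thesis using cyl_self by blast
      qed blast
    qed (use U in blast)
    then have "dense_open (E n)" for n using D by (simp add: E_def split: nat.split)
    moreover have "x \<in> UNIV - a \<longleftrightarrow> x \<in> interior (- U)" if "\<forall>n. x \<in> E n" for x
    proof -
      have "x \<in> E 0" "\<forall>n. x \<in> E (Suc n)" using that by blast+
      then have "x \<in> U \<union> interior (- U)" "\<forall>n. x \<in> D n" by (simp_all add: E_def)
      then show ?thesis using eq interior_subset[of "- U"] by blast
    qed
    ultimately show ?case by (intro exI[of _ "interior (- U)"] exI[of _ E]) simp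
  next
    case (Union a)
    then obtain U D where U: "\<And>i. open (U i)" and D: "\<And>i n::nat. dense_open (D i n)"
      and eq: "\<And>i x. (\<forall>n. x \<in> D i n) \<Longrightarrow> (x \<in> a i \<longleftrightarrow> x \<in> U i)" by metis
    define E where "E q = (case prod_decode q of (i, n) \<Rightarrow> D i n)" for q
    have "dense_open (E q)" for q using D by (simp add: E_def split: prod.split)
    moreover have "x \<in> (\<Union>i. a i) \<longleftrightarrow> x \<in> (\<Union>i. U i)" if "\<forall>q. x \<in> E q" for x
    proof -
      have "x \<in> D i n" for i n using spec[OF that, of "prod_encode (i, n)"] by (simp add: E_def)
      then have "x \<in> a i \<longleftrightarrow> x \<in> U i" for i by (intro eq allI)
      then show ?thesis by simp
    qed
    moreover have "open (\<Union>i. U i)" using U by blast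
    ultimately show ?case by (intro exI[of _ "\<Union>i. U i"] exI[of _ E] conjI) simp_all
  qed
qed

text \<open>With \<open>i\<close> varying, these are the index sequences of the points of one edge:
  \<open>s\<close> gives the common stem below \<open>m\<close> and \<open>b\<close> the common
  tail.\<close>

definition graft :: "(nat \<Rightarrow> nat) \<Rightarrow> nat \<Rightarrow> nat \<Rightarrow> (nat \<Rightarrow> nat) \<Rightarrow> nat \<Rightarrow> nat" where
  "graft s m i b = (\<lambda>x. if x < m then s x else if x = m then i else b x)"

text \<open>The map forgets the values of its argument up to \<open>m\<close>. A point of
  \<open>D\<close> close to the graft of \<open>x\<close> is therefore itself the graft of a
  sequence that differs from \<open>x\<close> only far beyond \<open>m\<close>.\<close>

lemma dense_open_vimage_graft:
  assumes "dense_open D"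
  shows "dense_open (graft s m i -` D)"
  unfolding dense_open_def
proof (intro conjI allI)
  have "continuous_on UNIV (graft s m i)"
  proof (rule continuous_on_UNIV_cyl_iff)
    fix x n
    show "\<exists>r. \<forall>y\<in>cyl x r. graft s m i y n = graft s m i x n"
      by (rule exI[of _ "Suc n"]) (simp add: graft_def cyl_def)
  qed
  then show "open (graft s m i -` D)"
    using assms by (intro open_vimage) (auto simp: dense_open_def)
next
  fix x n
  obtain c where c: "c \<in> D" "c \<in> cyl (graft s m i x) (max n (Suc m))"
    using assms unfolding dense_open_def by blast
  define b where "b j = (if j \<le> m then x j else c j)" for j
  have "graft s m i b = c"
    using c(2) by (auto simp: graft_def b_def cyl_def fun_eq_iff)
  moreover have "b \<in> cyl x n"
    using c(2) by (auto simp: graft_def b_def cyl_def)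
  ultimately show "graft s m i -` D \<inter> cyl x n \<noteq> {}" using c(1) by blast
qed

text \<open>Some \<open>A j\<close> is comeager in a cylinder, which contains a stem
  \<open>s m\<close> with \<open>R m j\<close>. Preimages of dense open sets under all grafts at
  \<open>m\<close> are dense open, so a single generic tail \<open>b\<close> serves every
  \<open>i\<close>.\<close>

lemma borel_cover_contains_grafts:
  fixes A :: "nat \<Rightarrow> (nat \<Rightarrow> nat) set"
  assumes borel: "\<And>j. A j \<in> sets borel" and cover: "\<And>x. \<exists>j. x \<in> A j"
    and dense: "\<And>j x n. \<exists>m\<ge>n. R m j \<and> s m \<in> cyl x n"
  shows "\<exists>j m b. R m j \<and> (\<forall>i. graft (s m) m i b \<in> A j)"
proof -
  obtain U D where U: "\<And>j. open (U j)" and D: "\<And>j n::nat. dense_open (D j n)"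
    and eq: "\<And>j x. (\<forall>n. x \<in> D j n) \<Longrightarrow> (x \<in> A j \<longleftrightarrow> x \<in> U j)"
    using borel_baire_property[OF borel] by metis
  have "\<exists>y. \<forall>q. y \<in> (case prod_decode q of (j, n) \<Rightarrow> D j n)"
    by (rule baire_category) (simp add: D split: prod.split)
  then obtain y where y: "\<And>q. y \<in> (case prod_decode q of (j, n) \<Rightarrow> D j n)" by blast
  have y: "y \<in> D j n" for j n
    using y[of "prod_encode (j, n)"] by simp
  obtain j where "y \<in> A j" using cover by blast
  then have "y \<in> U j" using eq y by blast
  then obtain n where n: "cyl y n \<subseteq> U j" using open_contains_cyl[OF U] by blast
  obtain m where m: "m \<ge> n" "R m j" "s m \<in> cyl y n" using dense by blast
  have "\<exists>b. \<forall>q. b \<in> (case prod_decode q of (i, n) \<Rightarrow> graft (s m) m i -` D j n)"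
    by (rule baire_category) (simp add: D dense_open_vimage_graft split: prod.split)
  then obtain b where b: "\<And>q. b \<in> (case prod_decode q of (i, n) \<Rightarrow> graft (s m) m i -` D j n)"
    by blast
  have "graft (s m) m i b \<in> A j" for i
  proof -
    have "graft (s m) m i b \<in> D j n" for n
      using b[of "prod_encode (i, n)"] by simp
    moreover have "graft (s m) m i b \<in> U j"
      using m n by (auto simp: graft_def cyl_def subset_iff)
    ultimately show ?thesis using eq by blast
  qed
  then show ?thesis using m(2) by blast
qed

section \<open>Fusion of configurations of edges\<close>

lemma sigma_ideal_generated_subset:
  "A \<in> sigma_ideal_generated \<S> \<Longrightarrow> B \<subseteq> A \<Longrightarrow> B \<in> sigma_ideal_generated \<S>"
  unfolding sigma_ideal_generated_def by blast

lemma sigma_ideal_generated_base: "A \<in> \<S> \<Longrightarrow> A \<in> sigma_ideal_generated \<S>"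
  unfolding sigma_ideal_generated_def by (auto intro!: exI[of _ "{A}"])

lemma sigma_ideal_generated_UN:
  assumes "countable I" "\<And>i. i \<in> I \<Longrightarrow> A i \<in> sigma_ideal_generated \<S>"
  shows "(\<Union>i\<in>I. A i) \<in> sigma_ideal_generated \<S>"
proof -
  have "\<forall>i\<in>I. \<exists>\<C>. countable \<C> \<and> \<C> \<subseteq> \<S> \<and> A i \<subseteq> \<Union>\<C>"
    using assms(2) unfolding sigma_ideal_generated_def by blast
  then obtain \<C> where \<C>: "\<And>i. i \<in> I \<Longrightarrow> countable (\<C> i) \<and> \<C> i \<subseteq> \<S> \<and> A i \<subseteq> \<Union>(\<C> i)"
    by metis
  have "countable (\<Union>i\<in>I. \<C> i)" using assms(1) \<C> by blast
  moreover have "(\<Union>i\<in>I. \<C> i) \<subseteq> \<S>" using \<C> by blast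
  moreover have "(\<Union>i\<in>I. A i) \<subseteq> \<Union>(\<Union>i\<in>I. \<C> i)" using \<C> by fastforce
  ultimately show ?thesis unfolding sigma_ideal_generated_def by blast
qed

lemma sigma_ideal_generated_Un:
  assumes "A \<in> sigma_ideal_generated \<S>" "B \<in> sigma_ideal_generated \<S>"
  shows "A \<union> B \<in> sigma_ideal_generated \<S>"
  using sigma_ideal_generated_UN[of "UNIV :: bool set" "\<lambda>i. if i then A else B" \<S>] assms
  by (simp add: UNIV_bool Un_commute)

text \<open>
  The \<open>j\<close>-th hypergraph is given by the parametrised edges \<open>(g j 0 w, \<dots>, g j (k j - 1) w)\<close>. Shorter
  edges are padded by repeating an entry, so all edges of one hypergraph have the same length.
\<close>

locale edge_maps =
  fixes k :: "nat \<Rightarrow> nat" and g :: "nat \<Rightarrow> nat \<Rightarrow> (nat \<Rightarrow> nat) \<Rightarrow> 'a::polish_space"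
  assumes k_pos: "0 < k j" and g_cont: "continuous_on UNIV (g j i)"
begin

definition edge_free :: "nat \<Rightarrow> 'a set \<Rightarrow> bool" where
  "edge_free j A \<longleftrightarrow> (\<nexists>w. \<forall>i<k j. g j i w \<in> A)"

definition edge_ideal :: "'a set set" where
  "edge_ideal = sigma_ideal_generated {B. B \<in> sets borel \<and> (\<exists>j. edge_free j B)}"

end

text \<open>
  A configuration of level \<open>n\<close> assigns a point of \<open>F\<close> to every \<open>b \<in> \<Prod>i<n. arity i\<close> and edge parameters
  witnessing that at each stage \<open>m < n\<close> the points with indices extending \<open>s m 0, \<dots>, s m (m - 1), i\<close>,
  for \<open>i < arity m\<close>, and agreeing beyond \<open>m\<close> are mapped by \<open>\<psi>\<close> to an edge of hypergraph \<open>l m\<close>. It is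
  coded by one real: section \<open>0\<close> is the edge parameter of the last stage, section \<open>i + 1\<close> is the
  configuration of level \<open>n - 1\<close> below \<open>i\<close>. Indices are reduced modulo the arities, so that all
  of \<^typ>\<open>nat \<Rightarrow> nat\<close> can serve as the index space. The function \<open>component m n b\<close> descends along \<open>b\<close>
  from level \<open>n\<close> to level \<open>m\<close>.
\<close>

locale fusion = edge_maps k g
  for k :: "nat \<Rightarrow> nat" and g :: "nat \<Rightarrow> nat \<Rightarrow> (nat \<Rightarrow> nat) \<Rightarrow> 'a::polish_space" +
  fixes l :: "nat \<Rightarrow> nat" and s :: "nat \<Rightarrow> nat \<Rightarrow> nat"
    and F :: "(nat \<Rightarrow> nat) set" and \<psi> :: "(nat \<Rightarrow> nat) \<Rightarrow> 'a"
  assumes closed_F: "closed F" and \<psi>_cont: "continuous_on F \<psi>"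
begin

abbreviation "arity n \<equiv> k (l n)"

primrec component :: "nat \<Rightarrow> nat \<Rightarrow> (nat \<Rightarrow> nat) \<Rightarrow> (nat \<Rightarrow> nat) \<Rightarrow> nat \<Rightarrow> nat" where
  "component m 0 b z = z"
| "component m (Suc n) b z = (if m \<le> n then component m n b (sect (Suc (b n mod arity n)) z) else z)"

primrec configurations :: "nat \<Rightarrow> (nat \<Rightarrow> nat) set \<Rightarrow> (nat \<Rightarrow> nat) set" where
  "configurations 0 Q = Q"
| "configurations (Suc n) Q = {z. (\<forall>i<arity n. sect (Suc i) z \<in> configurations n Q) \<and>
     (\<forall>i<arity n. g (l n) i (sect 0 z) = \<psi> (component 0 n (s n) (sect (Suc i) z)))}"

section \<open>Components of configurations, and the complexity of sets of configurations\<close>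

lemma component_self [simp]: "component n n b z = z"
  by (cases n) auto

lemma mod_arity: "i mod arity n < arity n"
  by (simp add: k_pos)

lemma component_configurations: "m \<le> n \<Longrightarrow> z \<in> configurations n Q \<Longrightarrow> component m n b z \<in> configurations m Q"
proof (induction n arbitrary: z)
  case (Suc n)
  then show ?case
  proof (cases "m \<le> n")
    case True
    have "sect (Suc (b n mod arity n)) z \<in> configurations n Q" using Suc.prems(2) mod_arity by simp
    then show ?thesis using Suc.IH True by simp
  next
    case False
    then have "m = Suc n" using Suc.prems(1) by simp
    then show ?thesis using Suc.prems(2) by (simp only: component_self)
  qed
qed simp

lemma component_cong:
  "(\<And>j. m \<le> j \<Longrightarrow> j < n \<Longrightarrow> b j mod arity j = b' j mod arity j) \<Longrightarrow> component m n b z = component m n b' z"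
  by (induction n arbitrary: z) auto

lemma component_Suc_left: "Suc m \<le> n \<Longrightarrow> component m n b z = sect (Suc (b m mod arity m)) (component (Suc m) n b z)"
proof (induction n arbitrary: z)
  case (Suc n)
  then show ?case
  proof (cases "m = n")
    case True
    then show ?thesis by (simp only: component_self) (simp only: component.simps(2) order_refl if_True component_self)
  next
    case False
    then have "Suc m \<le> n" using Suc.prems by simp
    then show ?thesis using Suc.IH by simp
  qed
qed simp

text \<open>The modulus \<open>r\<close> is uniform in \<open>b\<close> because only the
  \<open>arity n\<close> sections of a configuration of level \<open>n + 1\<close> can occur on the
  way down.\<close>

lemma component_uniform: "\<exists>r. \<forall>b z. \<forall>y\<in>cyl z r. component m n b y \<in> cyl (component m n b z) L"
proof (induction n)
  case (Suc n)
  then obtain r where r: "\<And>b z y. y \<in> cyl z r \<Longrightarrow> component m n b y \<in> cyl (component m n b z) L" by blast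
  obtain q where q: "\<forall>i\<le>arity n. \<forall>j<r. prod_encode (i, j) < q" using prod_encode_bounded by blast
  show ?case
  proof (intro exI[of _ "max q L"] allI ballI)
    fix b z y assume y: "y \<in> cyl z (max q L)"
    have "sect (Suc (b n mod arity n)) y \<in> cyl (sect (Suc (b n mod arity n)) z) r"
    proof -
      have "prod_encode (Suc (b n mod arity n), j) < q" if "j < r" for j
        using q that mod_arity[of "b n" n] by (simp add: Suc_le_eq)
      then show ?thesis using y by (simp add: sect_def cyl_def less_max_iff_disj)
    qed
    from r[OF this] show "component m (Suc n) b y \<in> cyl (component m (Suc n) b z) L"
      using y cyl_antimono[of L "max q L" z] by auto
  qed
qed auto

lemma continuous_on_component: "continuous_on S (component m n b)"
proof -
  have "\<exists>r. \<forall>y\<in>cyl x r. component m n b y j = component m n b x j" for x j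
  proof -
    obtain r where "\<And>b z y. y \<in> cyl z r \<Longrightarrow> component m n b y \<in> cyl (component m n b z) (Suc j)"
      using component_uniform by metis
    then show ?thesis by (intro exI[of _ r]) (auto simp: cyl_def)
  qed
  then show ?thesis
    using continuous_on_UNIV_cyl_iff continuous_on_subset by blast
qed

lemma configurations_mono: "Q \<subseteq> Q' \<Longrightarrow> configurations n Q \<subseteq> configurations n Q'"
  by (induction n) auto

lemma component_0_in_F: "z \<in> configurations n F \<Longrightarrow> component 0 n b z \<in> F"
  using component_configurations[of 0 n z F] by simp

lemma continuous_on_\<psi>_component:
  assumes "\<And>z. z \<in> S \<Longrightarrow> f z \<in> configurations n F" "continuous_on S f"
  shows "continuous_on S (\<lambda>z. \<psi> (component 0 n b (f z)))"
proof (rule continuous_on_compose2[OF \<psi>_cont])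
  show "continuous_on S (\<lambda>z. component 0 n b (f z))"
    by (rule continuous_on_compose2[OF continuous_on_component assms(2) order_refl])
  show "(\<lambda>z. component 0 n b (f z)) ` S \<subseteq> F" using assms(1) component_0_in_F by blast
qed

lemma closed_configurations: "closed (configurations n F)"
proof (induction n)
  case 0
  then show ?case using closed_F by simp
next
  case (Suc n)
  define S where "S = (\<Inter>i\<in>{..<arity n}. sect (Suc i) -` configurations n F)"
  have S: "closed S"
    unfolding S_def by (intro closed_INT ballI closed_vimage Suc.IH continuous_on_sect)
  have "closed {z \<in> S. g (l n) i (sect 0 z) = \<psi> (component 0 n (s n) (sect (Suc i) z))}" if i: "i < arity n" for i
  proof (rule closed_Collect_eq_on[OF closed_diagonal_t2 S])
    show "continuous_on S (\<lambda>z. g (l n) i (sect 0 z))"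
      by (rule continuous_on_compose2[OF g_cont continuous_on_sect]) simp
    show "continuous_on S (\<lambda>z. \<psi> (component 0 n (s n) (sect (Suc i) z)))"
      by (rule continuous_on_\<psi>_component) (use i in \<open>auto simp: S_def continuous_on_sect\<close>)
  qed
  then have "closed (\<Inter>i\<in>{..<arity n}. {z \<in> S. g (l n) i (sect 0 z) = \<psi> (component 0 n (s n) (sect (Suc i) z))})"
    by (intro closed_INT) auto
  also have "(\<Inter>i\<in>{..<arity n}. {z \<in> S. g (l n) i (sect 0 z) = \<psi> (component 0 n (s n) (sect (Suc i) z))}) = configurations (Suc n) F"
    using k_pos[of "l n"] by (auto simp: S_def)
  finally show ?case .
qed

lemma configurations_borel:
  assumes "Q \<in> sets borel" "Q \<subseteq> F"
  shows "configurations n Q \<in> sets borel"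
proof (induction n)
  case 0
  then show ?case using assms by simp
next
  case (Suc n)
  have "sect (Suc i) -` configurations n Q \<in> sets borel" for i
  proof -
    have "sect (Suc i) \<in> measurable borel borel"
      by (intro borel_measurable_continuous_onI continuous_on_sect)
    from measurable_sets[OF this Suc.IH] show ?thesis by simp
  qed
  then have "(\<Inter>i\<in>{..<arity n}. sect (Suc i) -` configurations n Q) \<in> sets borel"
    using k_pos[of "l n"] by (intro sets.finite_INT) auto
  \<comment> \<open>The edge equations are supplied by the closed set over \<open>F\<close>, where
    \<open>\<psi>\<close> is continuous; membership in \<open>Q\<close> concerns the sections
    alone.\<close>
  moreover have "configurations (Suc n) Q = (\<Inter>i\<in>{..<arity n}. sect (Suc i) -` configurations n Q) \<inter> configurations (Suc n) F"
    using configurations_mono[OF assms(2), of n] by auto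
  moreover have "configurations (Suc n) F \<in> sets borel" using closed_configurations by (intro borel_closed)
  ultimately show ?case by (metis sets.Int)
qed

section \<open>Large sets of configurations\<close>

lemma avoid_borel:
  assumes "N \<in> sets borel"
  shows "F \<inter> \<psi> -` (- N) \<in> sets borel"
proof -
  have "\<psi> \<in> borel_measurable (restrict_space borel F)"
    by (rule borel_measurable_continuous_on_restrict[OF \<psi>_cont])
  moreover have "- N \<in> sets borel" using assms by (simp add: borel_comp)
  ultimately have "\<psi> -` (- N) \<inter> space (restrict_space borel F) \<in> sets (restrict_space borel F)"
    by (rule measurable_sets)
  moreover have "F \<in> sets borel" using closed_F by (rule borel_closed)
  ultimately show ?thesis
    by (simp add: sets_restrict_space_iff space_restrict_space Int_commute)
qed

text \<open>This is positivity for sets of configurations: no Borel set of the ideal meets all of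
  them. In particular, \<open>large 0 UNIV\<close> says that no Borel set of the ideal covers the
  image of \<open>F\<close>.\<close>

definition large :: "nat \<Rightarrow> (nat \<Rightarrow> nat) set \<Rightarrow> bool" where
  "large n V \<longleftrightarrow> (\<forall>N\<in>edge_ideal. N \<in> sets borel \<longrightarrow> V \<inter> configurations n (F \<inter> \<psi> -` (- N)) \<noteq> {})"

lemma large_mono: "large n V \<Longrightarrow> V \<subseteq> W \<Longrightarrow> large n W"
  unfolding large_def by blast

text \<open>
  If no edge of hypergraph \<open>l n\<close> joined points occurring in \<open>V\<close> outside \<open>N\<close>, these points would form an
  analytic anticlique, hence lie in a Borel one. Adding it to \<open>N\<close> contradicts the largeness
  of \<open>V\<close>.
\<close>

lemma large_Suc:
  assumes "large n V" "V \<in> sets borel"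
  shows "large (Suc n) {z. \<forall>i<arity n. sect (Suc i) z \<in> V}"
  unfolding large_def
proof (intro ballI impI)
  fix N assume N: "N \<in> edge_ideal" "N \<in> sets borel"
  define Q where "Q M = F \<inter> \<psi> -` (- M)" for M
  define A where "A = (\<lambda>z. \<psi> (component 0 n (s n) z)) ` (V \<inter> configurations n (Q N))"
  have QF: "Q M \<subseteq> F" for M by (auto simp: Q_def)
  have "V \<inter> configurations n (Q N) \<in> sets borel"
    using assms(2) configurations_borel[OF avoid_borel[OF N(2)]] by (auto simp: Q_def)
  moreover have "continuous_on (V \<inter> configurations n (Q N)) (\<lambda>z. \<psi> (component 0 n (s n) z))"
    using configurations_mono[OF QF] by (intro continuous_on_\<psi>_component) (auto intro: continuous_on_id)
  ultimately have "suslin A"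
    unfolding A_def by (intro suslin_image suslin_borel_baire)
  have "\<not> edge_free (l n) A"
  proof
    assume "edge_free (l n) A"
    then obtain B where B: "B \<in> sets borel" "A \<subseteq> B" "\<nexists>w. \<forall>i<arity n. g (l n) i w \<in> B"
      using suslin_anticlique_separation[of "g (l n)" A "arity n", OF g_cont \<open>suslin A\<close>]
      unfolding edge_free_def by metis
    then have "B \<in> edge_ideal" unfolding edge_ideal_def edge_free_def
      by (intro sigma_ideal_generated_base) blast
    then have "N \<union> B \<in> edge_ideal" using N(1) unfolding edge_ideal_def by (rule sigma_ideal_generated_Un[rotated])
    moreover have "N \<union> B \<in> sets borel" using N B by blast
    ultimately obtain z where z: "z \<in> V" "z \<in> configurations n (Q (N \<union> B))"
      using assms(1) unfolding large_def Q_def by blast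
    have "z \<in> configurations n (Q N)" using z(2) configurations_mono[of "Q (N \<union> B)" "Q N" n] by (auto simp: Q_def)
    then have "\<psi> (component 0 n (s n) z) \<in> B" using z(1) B(2) by (auto simp: A_def)
    moreover have "component 0 n (s n) z \<in> Q (N \<union> B)" using component_configurations[of 0 n z] z(2) by simp
    ultimately show False by (simp add: Q_def)
  qed
  then obtain w where "\<forall>i<arity n. g (l n) i w \<in> A" unfolding edge_free_def by blast
  then have "\<forall>i<arity n. \<exists>y. y \<in> V \<inter> configurations n (Q N) \<and> g (l n) i w = \<psi> (component 0 n (s n) y)"
    unfolding A_def by blast
  then obtain y where y: "\<And>i. i < arity n \<Longrightarrow> y i \<in> V \<inter> configurations n (Q N) \<and> g (l n) i w = \<psi> (component 0 n (s n) (y i))"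
    by metis
  \<comment> \<open>An edge with all entries in \<open>A\<close> comes with one configuration per
    entry. These and the edge parameter amalgamate to a configuration of the next level.\<close>
  define z where "z = tuple (case_nat w y)"
  have "sect 0 z = w" "sect (Suc i) z = y i" for i by (simp_all add: z_def)
  then have "z \<in> {z. \<forall>i<arity n. sect (Suc i) z \<in> V} \<inter> configurations (Suc n) (Q N)" using y by simp
  then show "{z. \<forall>i<arity n. sect (Suc i) z \<in> V} \<inter> configurations (Suc n) (F \<inter> \<psi> -` (- N)) \<noteq> {}"
    unfolding Q_def by blast
qed

text \<open>There are only countably many initial segments of length \<open>r\<close>. If none of
  them cut out a large part of \<open>V\<close>, the union of the witnessing sets would be in the
  ideal and refute the largeness of \<open>V\<close>.\<close>

lemma large_shrink:
  assumes "large n V"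
  shows "\<exists>z\<in>V \<inter> configurations n F. large n (V \<inter> cyl z r)"
proof -
  have "\<exists>xs. large n (V \<inter> {z. map z [0..<r] = xs})"
  proof (rule ccontr)
    assume "\<not> (\<exists>xs. large n (V \<inter> {z. map z [0..<r] = xs}))"
    then have "\<forall>xs. \<exists>N. N \<in> edge_ideal \<and> N \<in> sets borel \<and> V \<inter> {z. map z [0..<r] = xs} \<inter> configurations n (F \<inter> \<psi> -` (- N)) = {}"
      unfolding large_def by blast
    then obtain N where N: "\<And>xs. N xs \<in> edge_ideal" "\<And>xs. N xs \<in> sets borel"
      "\<And>xs. V \<inter> {z. map z [0..<r] = xs} \<inter> configurations n (F \<inter> \<psi> -` (- N xs)) = {}"
      by metis
    have "(\<Union>xs. N xs) \<in> edge_ideal" "(\<Union>xs. N xs) \<in> sets borel"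
      using N(1,2) unfolding edge_ideal_def by (auto intro!: sigma_ideal_generated_UN)
    then obtain z where z: "z \<in> V" "z \<in> configurations n (F \<inter> \<psi> -` (- (\<Union>xs. N xs)))"
      using assms unfolding large_def by blast
    have "configurations n (F \<inter> \<psi> -` (- (\<Union>xs. N xs))) \<subseteq> configurations n (F \<inter> \<psi> -` (- N (map z [0..<r])))"
      by (rule configurations_mono) auto
    then show False using z N(3)[of "map z [0..<r]"] by blast
  qed
  then obtain xs where xs: "large n (V \<inter> {z. map z [0..<r] = xs})" by blast
  have "{} \<in> edge_ideal" unfolding edge_ideal_def sigma_ideal_generated_def by blast
  then obtain z where z: "z \<in> V" "map z [0..<r] = xs" "z \<in> configurations n (F \<inter> \<psi> -` (- {}))"
    using xs unfolding large_def by blast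
  have "{z. map z [0..<r] = xs} = cyl z r"
    using z(2) by (auto simp: cyl_def)
  then show ?thesis using xs z by auto
qed

text \<open>Largeness of a cylinder around \<open>z n\<close> passes to the next level, so all
  relevant sections of \<open>z (Suc n)\<close> can stay in that cylinder while some cylinder around
  \<open>z (Suc n)\<close> is large again.\<close>

lemma fusion_sequence:
  assumes "large 0 UNIV"
  shows "\<exists>z. \<forall>n. z n \<in> configurations n F \<and> (\<forall>i<arity n. sect (Suc i) (z (Suc n)) \<in> cyl (z n) (r n))"
proof -
  define P where "P n z \<longleftrightarrow> z \<in> configurations n F \<and> large n (cyl z (r n))" for n z
  define Q where "Q n z z' \<longleftrightarrow> (\<forall>i<arity n. sect (Suc i) z' \<in> cyl z (r n))" for n z z'
  have "\<exists>f. \<forall>n. P n (f n) \<and> Q n (f n) (f (Suc n))"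
  proof (rule dependent_nat_choice[where P = P and Q = Q])
    show "\<exists>z. P 0 z"
      using large_shrink[OF assms, of "r 0"] by (auto simp: P_def)
    show "\<exists>z'. P (Suc n) z' \<and> Q n z z'" if "P n z" for n z
    proof -
      have "large n (cyl z (r n))" "cyl z (r n) \<in> sets borel"
        using that open_cyl by (auto simp: P_def)
      from large_shrink[OF large_Suc[OF this], of "r (Suc n)"]
      obtain z' where z': "\<forall>i<arity n. sect (Suc i) z' \<in> cyl z (r n)" "z' \<in> configurations (Suc n) F"
        "large (Suc n) ({z'. \<forall>i<arity n. sect (Suc i) z' \<in> cyl z (r n)} \<inter> cyl z' (r (Suc n)))"
        by blast
      from large_mono[OF z'(3) Int_lower2] z'(1,2) show ?thesis unfolding P_def Q_def by blast
    qed
  qed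
  then show ?thesis unfolding P_def Q_def by blast
qed

text \<open>For fixed \<open>m\<close> and \<open>b\<close> the components of \<open>z n\<close> at
  level \<open>m\<close> converge, and \<open>U m b\<close> is their limit. Precision
  \<open>L n\<close> is reached at stage \<open>n\<close>, so the first \<open>L n\<close> values of
  \<open>U 0 b\<close> depend only on the first \<open>n\<close> indices.\<close>

lemma fusion_limit:
  assumes "large 0 UNIV" and L: "\<And>n. n < L n" "mono L"
  obtains U where "\<And>m b. U m b \<in> configurations m F"
    and "\<And>m b. sect (Suc (b m mod arity m)) (U (Suc m) b) = U m b"
    and "\<And>m b b'. (\<And>j. m \<le> j \<Longrightarrow> b j mod arity j = b' j mod arity j) \<Longrightarrow> U m b = U m b'"
    and "\<And>n. \<exists>z. \<forall>b. U 0 b \<in> cyl (component 0 n b z) (L n)"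
proof -
  have "\<exists>r. \<forall>m\<le>n. \<forall>b z. \<forall>y\<in>cyl z r. component m n b y \<in> cyl (component m n b z) (L n)" for n
  proof -
    obtain r where r: "\<And>m b z y. y \<in> cyl z (r m) \<Longrightarrow> component m n b y \<in> cyl (component m n b z) (L n)"
      using component_uniform[of _ n "L n"] by metis
    have "cyl z (\<Sum>m\<le>n. r m) \<subseteq> cyl z (r m)" if "m \<le> n" for m z
      using that by (intro cyl_antimono member_le_sum) auto
    then show ?thesis using r by blast
  qed
  then obtain r where r: "\<And>n m b z y. m \<le> n \<Longrightarrow> y \<in> cyl z (r n) \<Longrightarrow> component m n b y \<in> cyl (component m n b z) (L n)"
    by metis
  obtain z where z: "\<And>n. z n \<in> configurations n F"
    and zr: "\<And>n i. i < arity n \<Longrightarrow> sect (Suc i) (z (Suc n)) \<in> cyl (z n) (r n)"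
    using fusion_sequence[OF assms(1), of r] by blast
  define u where "u m n b = component m n b (z n)" for m n b
  have step: "u m (Suc n) b \<in> cyl (u m n b) (L n)" if "m \<le> n" for m n b
    using r[OF that zr[OF mod_arity]] that by (simp add: u_def)
  have u: "u m n' b \<in> cyl (u m n b) (L n)" if "m \<le> n" "n \<le> n'" for m n n' b
    using that(2)
  proof (induction n' rule: dec_induct)
    case (step n')
    have "L n \<le> L n'" using step(1) L(2) by (simp add: monoD)
    then show ?case
      using step.IH \<open>\<And>m n b. m \<le> n \<Longrightarrow> u m (Suc n) b \<in> cyl (u m n b) (L n)\<close>[of m n' b] that(1) step(1)
      by (auto simp: cyl_def)
  qed simp
  \<comment> \<open>Since \<open>j < L (max m j)\<close>, value \<open>j\<close> no longer changes
    after stage \<open>max m j\<close>.\<close>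
  define U where "U m b = (\<lambda>j. u m (max m j) b j)" for m b
  have lim: "U m b \<in> cyl (u m n b) (L n)" if "m \<le> n" for m n b
    unfolding cyl_def
  proof (clarify)
    fix j assume j: "j < L n"
    have "j < L (max m j)" using L(1)[of "max m j"] by simp
    then show "U m b j = u m n b j"
      using u[of m n "max m j" b] u[of m "max m j" n b] j that
      by (cases "n \<le> max m j") (auto simp: U_def cyl_def)
  qed
  show thesis
  proof
    show "U m b \<in> configurations m F" for m b
    proof (rule closed_limit_cyl[OF closed_configurations])
      fix q
      have "q < L (max m q)" using L(1)[of "max m q"] by simp
      then have "u m (max m q) b \<in> cyl (U m b) q"
        using lim[of m "max m q" b] by (simp add: cyl_def)
      moreover have "u m (max m q) b \<in> configurations m F"
        unfolding u_def by (rule component_configurations) (simp_all add: z)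
      ultimately show "\<exists>y\<in>configurations m F. y \<in> cyl (U m b) q" by blast
    qed
    show "sect (Suc (b m mod arity m)) (U (Suc m) b) = U m b" for m b
    proof
      fix j
      define q where "q = prod_encode (Suc (b m mod arity m), j)"
      define n where "n = Suc m + q + j"
      have n: "q < L n" "j < L n" "Suc m \<le> n" using L(1)[of n] by (simp_all add: n_def)
      have "U (Suc m) b q = u (Suc m) n b q" "U m b j = u m n b j"
        using lim[of "Suc m" n b] lim[of m n b] n by (simp_all add: cyl_def)
      moreover have "u m n b j = u (Suc m) n b q"
        unfolding u_def component_Suc_left[OF n(3)] by (simp add: sect_def q_def)
      ultimately show "sect (Suc (b m mod arity m)) (U (Suc m) b) j = U m b j"
        by (simp add: sect_def q_def)
    qed
    show "U m b = U m b'" if "\<And>j. m \<le> j \<Longrightarrow> b j mod arity j = b' j mod arity j" for m b b'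
      unfolding U_def u_def using component_cong[of m _ b b'] that by simp
    show "\<exists>z. \<forall>b. U 0 b \<in> cyl (component 0 n b z) (L n)" for n
      using lim[of 0 n] by (auto simp: u_def)
  qed
qed

lemma finite_component_values:
  "finite (range (\<lambda>b. component 0 n b z j)) \<and> card (range (\<lambda>b. component 0 n b z j)) \<le> (\<Prod>i<n. arity i)"
proof (induction n arbitrary: z)
  case (Suc n)
  define R where "R i = range (\<lambda>b. component 0 n b (sect (Suc i) z) j)" for i
  have R: "finite (R i)" "card (R i) \<le> (\<Prod>i<n. arity i)" for i using Suc.IH by (auto simp: R_def)
  have sub: "range (\<lambda>b. component 0 (Suc n) b z j) \<subseteq> (\<Union>i\<in>{..<arity n}. R i)"
    using mod_arity by (auto simp: R_def)
  have "card (\<Union>i\<in>{..<arity n}. R i) \<le> (\<Sum>i<arity n. card (R i))"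
    by (rule card_UN_le) simp
  also have "\<dots> \<le> (\<Sum>i<arity n. (\<Prod>i<n. arity i))" by (intro sum_mono R)
  finally have "card (\<Union>i\<in>{..<arity n}. R i) \<le> (\<Prod>i<Suc n. arity i)" by (simp add: mult.commute)
  moreover have "finite (\<Union>i\<in>{..<arity n}. R i)" using R by simp
  ultimately show ?case
    using sub finite_subset card_mono order_trans by metis
qed simp

end

text \<open>Each \<open>m\<close> is decoded as a triple. Its middle entry is a dummy that makes
  every pair of a hypergraph index and a finite stem recur at arbitrarily large
  \<open>m\<close>.\<close>

lemma frequent_enumeration:
  "\<exists>(l :: nat \<Rightarrow> nat) (s :: nat \<Rightarrow> nat \<Rightarrow> nat). \<forall>j x n. \<exists>m\<ge>n. l m = j \<and> s m \<in> cyl x n"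
proof -
  define l where "l m = fst (from_nat m :: nat \<times> nat \<times> nat list)" for m
  define xs where "xs m = snd (snd (from_nat m :: nat \<times> nat \<times> nat list))" for m
  define s where "s m i = (if i < length (xs m) then xs m ! i else 0)" for m i
  have "\<exists>m\<ge>n. l m = j \<and> s m \<in> cyl x n" for j x n
  proof -
    define c where "c q = to_nat (j, q :: nat, map x [0..<n])" for q
    have "inj c" by (simp add: inj_def c_def)
    then have "infinite (range c)" by (rule range_inj_infinite)
    then obtain q where "n \<le> c q" unfolding infinite_nat_iff_unbounded_le by blast
    moreover have "l (c q) = j" "s (c q) \<in> cyl x n"
      by (simp_all add: l_def s_def xs_def c_def cyl_def)
    ultimately show ?thesis by blast
  qed
  then show ?thesis by blast
qed

lemma compact_bounded_sequences: "compact {b :: nat \<Rightarrow> nat. \<forall>n. b n < q n}"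
proof -
  have "compactin (product_topology (\<lambda>_::nat. euclidean :: nat topology) UNIV) (PiE UNIV (\<lambda>n. {..<q n}))"
    unfolding compactin_PiE by (simp add: finite_imp_compact)
  then show ?thesis
    by (simp add: euclidean_product_topology PiE_def Pi_def)
qed

section \<open>A positive compact subset enclosed by a narrow tunnel\<close>

context edge_maps
begin

text \<open>Parametrising \<open>B\<close> through the sets \<open>B \<inter> D j m\<close> turns an
  index \<open>m\<close> with \<open>\<psi> z \<in> D j m\<close> into the digit
  \<open>z (e j)\<close>. The tunnel then consists of the values which this digit takes on the
  fusion limit.\<close>

lemma positive_compact_enclosed:
  assumes B: "B \<in> sets borel" "B \<notin> edge_ideal"
    and D: "\<And>j m. D j m \<in> sets borel" "\<And>j. B \<subseteq> (\<Union>m. D j m)"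
  obtains C T where "compact C" "C \<subseteq> B" "C \<notin> edge_ideal" "narrow_tunnel T" "\<And>j. C \<subseteq> (\<Union>m\<in>T j. D j m)"
proof -
  obtain F :: "(nat \<Rightarrow> nat) set" and \<psi> e where F: "closed F" and \<psi>: "continuous_on F \<psi>"
    and im: "\<psi> ` F = (\<Inter>j. \<Union>m. B \<inter> D j m)" and \<psi>D: "\<And>j z. z \<in> F \<Longrightarrow> \<psi> z \<in> B \<inter> D j (z (e j))"
    using suslin_INT_UN_witness[of "\<lambda>j m. B \<inter> D j m", OF closed_diagonal_t2 suslin_borel_polish[OF sets.Int[OF B(1) D(1)]]]
    by metis
  have "B \<subseteq> (\<Inter>j. \<Union>m. D j m)" using D(2) by (rule INT_greatest)
  then have im: "\<psi> ` F = B" unfolding im by auto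
  obtain l :: "nat \<Rightarrow> nat" and s :: "nat \<Rightarrow> nat \<Rightarrow> nat"
    where ls: "\<And>j x n. \<exists>m\<ge>n. l m = j \<and> s m \<in> cyl x n"
    using frequent_enumeration by metis
  interpret fusion k g l s F \<psi>
    by unfold_locales (rule F, rule \<psi>)
  have "large 0 UNIV"
    unfolding large_def
  proof (intro ballI impI notI)
    fix N assume "N \<in> edge_ideal" and "UNIV \<inter> configurations 0 (F \<inter> \<psi> -` (- N)) = {}"
    then have "B \<subseteq> N" using im by auto
    then show False using B(2) \<open>N \<in> edge_ideal\<close> sigma_ideal_generated_subset unfolding edge_ideal_def by blast
  qed
  define p where "p n = (\<Prod>i<n. arity i)" for n
  \<comment> \<open>At stage \<open>n\<close> all digits needed for the arguments \<open>j \<le> n + p (Suc n)\<close> get decided. As there are only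
    \<open>p n\<close> indices of length \<open>n\<close> and the digit for \<open>j\<close> is known at the last stage \<open>n \<le> j\<close> with
    \<open>p n \<le> 2 ^ j\<close>, it takes at most \<open>2 ^ j\<close> values.\<close>
  define L where "L n = Suc n + (\<Sum>q\<le>n. \<Sum>j\<le>q + p (Suc q). e j)" for n
  have L: "n < L n" "mono L" for n
    unfolding L_def mono_def by (auto intro!: add_mono sum_mono2)
  have eL: "e j < L n" if "j \<le> n + p (Suc n)" for j n
  proof -
    have "e j \<le> (\<Sum>j\<le>n + p (Suc n). e j)" using that by (intro member_le_sum) auto
    also have "\<dots> \<le> (\<Sum>q\<le>n. \<Sum>j\<le>q + p (Suc q). e j)"
      by (rule member_le_sum[where f = "\<lambda>q. \<Sum>j\<le>q + p (Suc q). e j"]) auto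
    finally show ?thesis by (simp add: L_def)
  qed
  obtain U where UH: "\<And>m b. U m b \<in> configurations m F"
    and Usect: "\<And>m b. sect (Suc (b m mod arity m)) (U (Suc m) b) = U m b"
    and Ucong: "\<And>m b b'. (\<And>j. m \<le> j \<Longrightarrow> b j mod arity j = b' j mod arity j) \<Longrightarrow> U m b = U m b'"
    and Ucyl: "\<And>n. \<exists>z. \<forall>b. U 0 b \<in> cyl (component 0 n b z) (L n)"
    using fusion_limit[of L, OF \<open>large 0 UNIV\<close> L] by metis
  have U0: "U 0 b = component 0 m b (U m b)" for m b
  proof (induction m)
    case (Suc m)
    then show ?case by (simp add: Usect)
  qed simp
  have U0F: "U 0 b \<in> F" for b using UH[of 0] by simp
  define \<phi> where "\<phi> b = \<psi> (U 0 b)" for b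
  \<comment> \<open>\<open>U (Suc m) b\<close> depends only on indices beyond \<open>m\<close>, so
    its edge parameter is common to all \<open>i\<close>. Its section \<open>i + 1\<close> descends
    along \<open>s m\<close> to the point indexed by the graft.\<close>
  have edge: "g (l m) i (sect 0 (U (Suc m) b)) = \<phi> (graft (s m) m i b)" if i: "i < arity m" for m i b
  proof -
    define b' where "b' = graft (s m) m i b"
    have b'm: "b' m mod arity m = i" using i by (simp add: b'_def graft_def)
    have "U (Suc m) b = U (Suc m) b'" by (rule Ucong) (simp add: b'_def graft_def)
    then have "sect (Suc i) (U (Suc m) b) = U m b'" using Usect[of b' m] b'm by simp
    moreover have "component 0 m (s m) z = component 0 m b' z" for z
      by (rule component_cong) (simp add: b'_def graft_def)
    ultimately have "component 0 m (s m) (sect (Suc i) (U (Suc m) b)) = U 0 b'"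
      using U0[of b' m] by simp
    moreover have "g (l m) i (sect 0 (U (Suc m) b)) = \<psi> (component 0 m (s m) (sect (Suc i) (U (Suc m) b)))"
      using UH[of "Suc m" b] i by simp
    ultimately show ?thesis by (simp add: \<phi>_def b'_def)
  qed
  have U_cont: "continuous_on UNIV (U 0)"
  proof (rule continuous_on_UNIV_cyl_iff)
    fix x n
    obtain z where z: "\<And>b. U 0 b \<in> cyl (component 0 n b z) (L n)" using Ucyl by blast
    have "U 0 y n = U 0 x n" if "y \<in> cyl x n" for y
    proof -
      have "component 0 n y z = component 0 n x z" using that by (intro component_cong) (simp add: cyl_def)
      then show ?thesis using z[of x] z[of y] L(1)[of n] by (simp add: cyl_def)
    qed
    then show "\<exists>r. \<forall>y\<in>cyl x r. U 0 y n = U 0 x n" by blast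
  qed
  have \<phi>_cont: "continuous_on UNIV \<phi>"
    unfolding \<phi>_def using U0F by (intro continuous_on_compose2[OF \<psi> U_cont]) auto
  define C where "C = range \<phi>"
  have "C = \<phi> ` {b. \<forall>n. b n < arity n}"
  proof -
    have "\<phi> b \<in> \<phi> ` {b. \<forall>n. b n < arity n}" for b
    proof -
      have "\<phi> b = \<phi> (\<lambda>n. b n mod arity n)" unfolding \<phi>_def by (subst Ucong[of 0 b "\<lambda>n. b n mod arity n"]) auto
      then show ?thesis using mod_arity by blast
    qed
    then show ?thesis unfolding C_def by blast
  qed
  then have "compact C"
    using compact_continuous_image[OF continuous_on_subset[OF \<phi>_cont subset_UNIV] compact_bounded_sequences] by simp
  have "C \<subseteq> B" using U0F im by (auto simp: C_def \<phi>_def)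
  have "C \<notin> edge_ideal"
  proof
    assume "C \<in> edge_ideal"
    then obtain \<C> where \<C>: "countable \<C>" "\<C> \<subseteq> {B. B \<in> sets borel \<and> (\<exists>j. edge_free j B)}" "C \<subseteq> \<Union>\<C>"
      unfolding edge_ideal_def sigma_ideal_generated_def by blast
    have "\<C> \<noteq> {}" using \<C>(3) by (auto simp: C_def)
    define A where "A i = from_nat_into \<C> i" for i
    have A: "range A = \<C>" unfolding A_def using \<C>(1) \<open>\<C> \<noteq> {}\<close> by (rule range_from_nat_into[rotated])
    then have "\<forall>i. A i \<in> sets borel \<and> (\<exists>j. edge_free j (A i))" using \<C>(2) by blast
    then obtain j where A_borel: "\<And>i. A i \<in> sets borel" and j: "\<And>i. edge_free (j i) (A i)" by metis
    have "\<phi> -` A i \<in> sets borel" for i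
      using measurable_sets[OF borel_measurable_continuous_onI[OF \<phi>_cont] A_borel] by simp
    moreover have "\<exists>i. b \<in> \<phi> -` A i" for b
    proof -
      have "\<phi> b \<in> \<Union>\<C>" using \<C>(3) by (auto simp: C_def)
      then show ?thesis using A by auto
    qed
    moreover have "\<exists>m\<ge>n. l m = j i \<and> s m \<in> cyl x n" for i x n using ls .
    \<comment> \<open>One \<open>A i\<close> contains the points of all grafts at some stage
      \<open>m\<close> devoted to a hypergraph for which \<open>A i\<close> is edge-free. By
      \<open>edge\<close>, these points form an edge.\<close>
    ultimately obtain i m b where m: "l m = j i" "\<And>q. graft (s m) m q b \<in> \<phi> -` A i"
      using borel_cover_contains_grafts[of "\<lambda>i. \<phi> -` A i" "\<lambda>m i. l m = j i" s] by metis
    then have "\<forall>q<k (j i). g (j i) q (sect 0 (U (Suc m) b)) \<in> A i"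
      using edge[of _ m b] by auto
    then show False using j[of i] unfolding edge_free_def by blast
  qed
  define T where "T j = range (\<lambda>b. U 0 b (e j))" for j
  have "finite (T j) \<and> card (T j) \<le> 2 ^ j" for j
  proof -
    define n where "n = Max {n. n \<le> j \<and> p n \<le> 2 ^ j}"
    have fin: "finite {n. n \<le> j \<and> p n \<le> 2 ^ j}" by simp
    have "0 \<in> {n. n \<le> j \<and> p n \<le> 2 ^ j}" by (simp add: p_def)
    then have "n \<in> {n. n \<le> j \<and> p n \<le> 2 ^ j}" unfolding n_def using fin by (intro Max_in) auto
    then have n: "n \<le> j" "p n \<le> 2 ^ j" by auto
    have "j \<le> n + p (Suc n)"
    proof (cases "n = j")
      case False
      have "Suc n \<notin> {n. n \<le> j \<and> p n \<le> 2 ^ j}"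
        using Max_ge[OF fin, of "Suc n", folded n_def] by auto
      then have "2 ^ j < p (Suc n)" using False n(1) by auto
      then show ?thesis using less_exp[of j] by linarith
    qed simp
    then have e: "e j < L n" by (rule eL)
    obtain z where z: "\<And>b. U 0 b \<in> cyl (component 0 n b z) (L n)" using Ucyl by blast
    have "T j = range (\<lambda>b. component 0 n b z (e j))"
      unfolding T_def using z e by (simp add: cyl_def)
    then show ?thesis
      using finite_component_values[of n z "e j"] n(2) unfolding p_def by simp
  qed
  then have "narrow_tunnel T" unfolding narrow_tunnel_def by blast
  moreover have "C \<subseteq> (\<Union>m\<in>T j. D j m)" for j
    using \<psi>D[OF U0F] by (auto simp: C_def \<phi>_def T_def)
  ultimately show thesis using that \<open>compact C\<close> \<open>C \<subseteq> B\<close> \<open>C \<notin> edge_ideal\<close> by blast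
qed

end

section \<open>Countable elementary submodels and forcing\<close>

instance fm :: countable
  by countable_datatype

text \<open>A formula has finitely many variables. Skolem functions can thus take finite lists in
  place of assignments, which keeps the Skolem hull countable.\<close>

lemma sat_local:
  fixes P :: "'a set"
  shows "\<exists>N. \<forall>M e e'. (\<forall>i<N. e i = e' i) \<longrightarrow>
    sat P le (M :: ('i, 'a) hset set) e \<phi> = sat P le M e' \<phi>"
proof (induction \<phi>)
  case (EqF x y)
  show ?case by (rule exI[of _ "Suc (max x y)"]) simp
next
  case (MemF x y)
  show ?case by (rule exI[of _ "Suc (max x y)"]) simp
next
  case (CondF x)
  show ?case by (rule exI[of _ "Suc x"]) simp
next
  case (LeF x y)
  show ?case by (rule exI[of _ "Suc (max x y)"]) simp
next
  case (NegF \<phi>)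
  then show ?case by simp
next
  case (ConjF \<phi> \<psi>)
  obtain N where N: "\<forall>M e e'. (\<forall>i<N. e i = e' i) \<longrightarrow>
      sat P le (M :: ('i, 'a) hset set) e \<phi> = sat P le M e' \<phi>"
    using ConjF.IH(1) by (rule exE)
  obtain N' where N': "\<forall>M e e'. (\<forall>i<N'. e i = e' i) \<longrightarrow>
      sat P le (M :: ('i, 'a) hset set) e \<psi> = sat P le M e' \<psi>"
    using ConjF.IH(2) by (rule exE)
  show ?case
  proof (intro exI[of _ "max N N'"] allI impI)
    fix M and e e' :: "nat \<Rightarrow> ('i, 'a) hset" assume "\<forall>i<max N N'. e i = e' i"
    then have "\<forall>i<N. e i = e' i" "\<forall>i<N'. e i = e' i" by simp_all
    from N[THEN spec, THEN spec, THEN spec, THEN mp, OF this(1)]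
      N'[THEN spec, THEN spec, THEN spec, THEN mp, OF this(2)]
    show "sat P le M e (ConjF \<phi> \<psi>) = sat P le M e' (ConjF \<phi> \<psi>)" by simp
  qed
next
  case (ExF x \<phi>)
  obtain N where N: "\<forall>M e e'. (\<forall>i<N. e i = e' i) \<longrightarrow>
      sat P le (M :: ('i, 'a) hset set) e \<phi> = sat P le M e' \<phi>"
    using ExF.IH by (rule exE)
  show ?case
  proof (intro exI[of _ N] allI impI)
    fix M and e e' :: "nat \<Rightarrow> ('i, 'a) hset" assume "\<forall>i<N. e i = e' i"
    then have "sat P le M (e(x := a)) \<phi> = sat P le M (e'(x := a)) \<phi>" for a
      by (intro N[THEN spec, THEN spec, THEN spec, THEN mp]) simp
    then show "sat P le M e (ExF x \<phi>) = sat P le M e' (ExF x \<phi>)" by simp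
  qed
qed

text \<open>The hull is closed under Skolem functions in \<omega> steps. Every finite list of
  parameters appears at a finite step, so the Tarski-Vaught criterion holds.\<close>

lemma countable_elementary_submodel_exists:
  fixes X :: "('i, 'a) hset set"
  assumes "countable X"
  shows "\<exists>M. countable M \<and> X \<subseteq> M \<and> elementary_submodel P le M"
proof -
  \<comment> \<open>\<open>c\<close> pads lists beyond the variables that matter, and as a member of
    the hull it makes the hull nonempty.\<close>
  define c where "c = (undefined :: ('i, 'a) hset)"
  define env where "env xs i = (if i < length xs then xs ! i else c)" for xs :: "('i, 'a) hset list" and i
  define sk where "sk = (\<lambda>(\<phi>, x, xs). SOME a. sat P le UNIV ((env xs)(x := a)) \<phi>)"
  define H where "H S = S \<union> sk ` (UNIV \<times> UNIV \<times> lists S)" for S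
  define Ms where "Ms n = (H ^^ n) (insert c X)" for n
  define M where "M = (\<Union>n. Ms n)"
  have Ms_Suc: "Ms (Suc n) = H (Ms n)" for n by (simp add: Ms_def)
  have "countable (Ms n)" for n
  proof (induction n)
    case 0
    then show ?case using assms by (simp add: Ms_def)
  next
    case (Suc n)
    then show ?case
      unfolding Ms_Suc H_def by (intro countable_Un countable_image countable_SIGMA countable_lists) auto
  qed
  then have "countable M" unfolding M_def by simp
  have cX: "c \<in> M" "X \<subseteq> M"
    unfolding M_def using UN_upper[of 0 UNIV Ms] by (auto simp: Ms_def)
  have mono: "Ms n \<subseteq> Ms m" if "n \<le> m" for n m
    using that by (rule lift_Suc_mono_le[rotated]) (auto simp: Ms_Suc H_def)
  have lists: "\<exists>n. xs \<in> lists (Ms n)" if "xs \<in> lists M" for xs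
    using that
  proof (induction xs)
    case (Cons x xs)
    then obtain n n' where "x \<in> Ms n" "xs \<in> lists (Ms n')" by (auto simp: M_def)
    then have "x \<in> Ms (max n n')" "xs \<in> lists (Ms (max n n'))"
      using mono[of n "max n n'"] lists_mono[OF mono[of n' "max n n'"]] by auto
    then show ?case by (intro exI[of _ "max n n'"]) simp
  qed simp
  have sk_in: "sk (\<phi>, x, xs) \<in> M" if "xs \<in> lists M" for \<phi> x xs
  proof -
    obtain n where "xs \<in> lists (Ms n)" using lists \<open>xs \<in> lists M\<close> by blast
    then have "sk (\<phi>, x, xs) \<in> Ms (Suc n)" unfolding Ms_Suc H_def by blast
    then show ?thesis unfolding M_def by blast
  qed
  have "sat P le M e \<phi> = sat P le UNIV e \<phi>" if "range e \<subseteq> M" for \<phi> e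
    using that
  proof (induction \<phi> arbitrary: e)
    case (ExF x \<phi>)
    have IH: "sat P le M (e(x := a)) \<phi> = sat P le UNIV (e(x := a)) \<phi>" if "a \<in> M" for a
      using ExF.prems that by (intro ExF.IH) auto
    have "\<exists>a\<in>M. sat P le UNIV (e(x := a)) \<phi>" if "sat P le UNIV (e(x := a)) \<phi>" for a
    proof -
      obtain N where N: "\<And>M e e'. (\<forall>i<N. e i = e' i) \<Longrightarrow>
          sat P le M e \<phi> = sat P le (M :: ('i, 'a) hset set) e' \<phi>"
        using sat_local[of P le \<phi>] by metis
      define xs where "xs = map e [0..<N]"
      have env: "sat P le UNIV ((env xs)(x := b)) \<phi> = sat P le UNIV (e(x := b)) \<phi>" for b
        by (rule N) (simp add: env_def xs_def)
      have "sat P le UNIV ((env xs)(x := a)) \<phi>" using that env by simp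
      then have "sat P le UNIV ((env xs)(x := sk (\<phi>, x, xs))) \<phi>"
        unfolding sk_def prod.case by (rule someI)
      moreover have "sk (\<phi>, x, xs) \<in> M"
        by (rule sk_in) (use ExF.prems in \<open>auto simp: xs_def image_subset_iff\<close>)
      ultimately show ?thesis using env by blast
    qed
    then show ?case using IH by auto
  qed simp_all
  then have "elementary_submodel P le M"
    unfolding elementary_submodel_def using cX(1) by blast
  then show ?thesis using \<open>countable M\<close> cX(2) by blast
qed

text \<open>The urelements embed into the index type by double singletons, so every set of
  urelements, in particular every dense set, is an element of the structure.\<close>

lemma is_set_of_atoms_exists: "\<exists>d :: (('a + nat) set set, 'a) hset. is_set_of_atoms d D"
proof -
  define h where "h x = {{Inl x :: 'a + nat}}" for x :: 'a
  have "inj h" by (simp add: inj_def h_def)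
  then have "D = inv h ` (h ` D)" by (simp add: image_inv_f_f)
  then show ?thesis unfolding is_set_of_atoms_def by blast
qed

lemma forces_val_mono:
  assumes "forces_val P (\<subseteq>) p \<tau> n m" "q \<subseteq> p"
  shows "forces_val P (\<subseteq>) q \<tau> n m"
  using assms unfolding forces_val_def dense_below_def by (meson order_trans)

lemma forces_function_mono:
  assumes "forces_function P (\<subseteq>) p \<tau>" "q \<subseteq> p"
  shows "forces_function P (\<subseteq>) q \<tau>"
  using assms unfolding forces_function_def dense_below_def by (meson order_trans)

section \<open>From hypergraphs of bounded arity to parametrised edges\<close>

lemma anticlique_Fin_Nil: "Fin [] \<in> G \<Longrightarrow> \<not> anticlique G A"
  unfolding anticlique_def by force

lemma hypergraph_edge_maps:
  fixes G :: "'a::topological_space hypergraph"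
  assumes "analytic_hypergraph G" "arity_le G n" "Fin [] \<notin> G" "G \<noteq> {}"
  shows "\<exists>k g. 0 < k \<and> (\<forall>i::nat. continuous_on UNIV (g i)) \<and>
    (\<forall>A. anticlique G A \<longleftrightarrow> (\<nexists>w :: nat \<Rightarrow> nat. \<forall>i<k. g i w \<in> A))"
proof -
  obtain f :: "(nat \<Rightarrow> nat) \<Rightarrow> 'a seq" where f: "continuous_map euclidean seq_topology f" "range f = G"
    using assms(1,4) unfolding analytic_hypergraph_def analyticin_def by blast
  have "\<exists>xs. f w = Fin xs \<and> xs \<noteq> [] \<and> length xs \<le> n" for w
  proof -
    have "f w \<in> G" using f(2) by blast
    then show ?thesis using assms(2,3) unfolding arity_le_def by (metis)
  qed
  then obtain xs where xs: "\<And>w. f w = Fin (xs w)" "\<And>w. xs w \<noteq> []" "\<And>w. length (xs w) \<le> n"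
    by metis
  \<comment> \<open>Repeating the last entry pads every edge to length \<open>n\<close> without
    changing its set of entries.\<close>
  define g where "g i w = xs w ! min i (length (xs w) - 1)" for i w
  have "continuous_on UNIV (g i)" for i
    unfolding continuous_on_open_vimage[OF open_UNIV]
  proof (intro allI impI)
    fix U :: "'a set" assume U: "open U"
    define V where "V = {Fin ys | ys. ys \<noteq> [] \<and> ys ! min i (length ys - 1) \<in> U}"
    have "open {x :: nat \<Rightarrow> 'a. Fin (map x [0..<m]) \<in> V}" for m
    proof (cases "m = 0")
      case False
      then have "{x :: nat \<Rightarrow> 'a. Fin (map x [0..<m]) \<in> V} = (\<lambda>x. x (min i (m - 1))) -` U"
        by (auto simp: V_def)
      then show ?thesis
        using open_vimage[OF U continuous_on_product_coordinates] by metis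
    qed (simp add: V_def)
    moreover have "{x. Inf x \<in> V} = {}" by (auto simp: V_def)
    ultimately have "openin seq_topology V"
      by (simp add: openin_seq_topology open_seqs_def)
    from openin_continuous_map_preimage[OF f(1) this] have "open {w. f w \<in> V}" by simp
    moreover have "{w. f w \<in> V} = g i -` U" using xs(1,2) by (auto simp: V_def g_def)
    ultimately show "open (g i -` U \<inter> UNIV)" by simp
  qed
  moreover have "anticlique G A \<longleftrightarrow> (\<nexists>w. \<forall>i<n. g i w \<in> A)" for A
  proof -
    have "set (xs w) \<subseteq> A \<longleftrightarrow> (\<forall>i<n. g i w \<in> A)" for w
    proof
      assume "set (xs w) \<subseteq> A"
      moreover have "g i w \<in> set (xs w)" for i
        unfolding g_def using xs(2)[of w] by (intro nth_mem) (cases "xs w"; simp add: min_def)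
      ultimately show "\<forall>i<n. g i w \<in> A" by blast
    next
      assume *: "\<forall>i<n. g i w \<in> A"
      show "set (xs w) \<subseteq> A"
      proof
        fix x assume "x \<in> set (xs w)"
        then obtain i where i: "i < length (xs w)" "x = xs w ! i" by (metis in_set_conv_nth)
        then have "i \<le> length (xs w) - 1" by simp
        then have "g i w = x" using i(2) by (simp add: g_def min_absorb1)
        moreover have "i < n" using i(1) xs(3)[of w] by simp
        ultimately show "x \<in> A" using * by blast
      qed
    qed
    moreover have "anticlique G A \<longleftrightarrow> (\<nexists>w. entries (f w) \<subseteq> A)"
      unfolding anticlique_def f(2)[symmetric] by blast
    ultimately show ?thesis using xs(1) by simp
  qed
  moreover have "0 < n" using xs(2,3)[of undefined] by (cases n) auto
  ultimately show ?thesis by blast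
qed

lemma hypergraph_positive_enclosed:
  fixes \<G> :: "'a::polish_space hypergraph set"
  assumes "countable \<G>"
    and "\<And>G. G \<in> \<G> \<Longrightarrow> analytic_hypergraph G"
    and "\<And>G. G \<in> \<G> \<Longrightarrow> \<exists>n. arity_le G n"
    and B: "B \<in> borel_positive (hypergraph_ideal \<G>)"
    and D: "\<And>j m. D j m \<in> sets borel" "\<And>j. B \<subseteq> (\<Union>m. D j m)"
  obtains C T where "C \<in> borel_positive (hypergraph_ideal \<G>)" "C \<subseteq> B" "narrow_tunnel T"
    "\<And>j. C \<subseteq> (\<Union>m\<in>T j. D j m)"
proof -
  have B_borel: "B \<in> sets borel" and B_pos: "B \<notin> hypergraph_ideal \<G>"
    using B by (auto simp: borel_positive_def)
  \<comment> \<open>A hypergraph with the empty edge has no anticliques at all, so dropping it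
    leaves the ideal unchanged.\<close>
  define \<G>' where "\<G>' = {G \<in> \<G>. Fin [] \<notin> G}"
  have eq: "(\<exists>G\<in>\<G>. anticlique G A) \<longleftrightarrow> (\<exists>G\<in>\<G>'. anticlique G A)" for A
    using anticlique_Fin_Nil by (auto simp: \<G>'_def)
  show thesis
  proof (cases "\<G>' = {}")
    case True
    then have ideal: "hypergraph_ideal \<G> = {{}}"
      unfolding hypergraph_ideal_def eq sigma_ideal_generated_def by auto
    then obtain x where x: "x \<in> B" using B_pos by auto
    have "\<forall>j. \<exists>m. x \<in> D j m" using D(2) x by blast
    then obtain t where t: "\<And>j. x \<in> D j (t j)" by metis
    show thesis
    proof
      show "{x} \<in> borel_positive (hypergraph_ideal \<G>)" by (simp add: borel_positive_def ideal)
      show "narrow_tunnel (\<lambda>j. {t j})" by (simp add: narrow_tunnel_def)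
    qed (use x t in auto)
  next
    case False
    define h where "h = from_nat_into \<G>'"
    have h: "range h = \<G>'"
      unfolding h_def by (rule range_from_nat_into[OF False]) (simp add: \<G>'_def assms(1))
    have "\<exists>k g. 0 < k \<and> (\<forall>i::nat. continuous_on UNIV (g i)) \<and>
      (\<forall>A. anticlique (h j) A \<longleftrightarrow> (\<nexists>w :: nat \<Rightarrow> nat. \<forall>i<k. g i w \<in> A))" for j
    proof -
      have hj: "h j \<in> \<G>" "Fin [] \<notin> h j" using h by (auto simp: \<G>'_def)
      obtain n where "arity_le (h j) n" using assms(3) hj(1) by blast
      \<comment> \<open>In an empty hypergraph every set is an anticlique, which would put
        \<open>B\<close> into the ideal.\<close>
      moreover have "h j \<noteq> {}"
      proof
        assume "h j = {}"
        then have "anticlique (h j) B" by (simp add: anticlique_def)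
        then have "B \<in> hypergraph_ideal \<G>"
          unfolding hypergraph_ideal_def using hj(1) B_borel by (intro sigma_ideal_generated_base) blast
        then show False using B_pos by simp
      qed
      ultimately show ?thesis
        using hypergraph_edge_maps[OF assms(2)[OF hj(1)] _ hj(2)] by blast
    qed
    then obtain k g where k: "\<And>j. 0 < k j" and g: "\<And>j i::nat. continuous_on UNIV (g j i)"
      and anti: "\<And>j A. anticlique (h j) A \<longleftrightarrow> (\<nexists>w :: nat \<Rightarrow> nat. \<forall>i<k j. g j i w \<in> A)"
      by metis
    interpret edge_maps k g
      by unfold_locales (rule k, rule g)
    have "edge_ideal = hypergraph_ideal \<G>"
    proof -
      have "(\<exists>G\<in>\<G>. anticlique G A) \<longleftrightarrow> (\<exists>j. edge_free j A)" for A
        unfolding eq h[symmetric] edge_free_def using anti by blast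
      then show ?thesis unfolding edge_ideal_def hypergraph_ideal_def by simp
    qed
    then obtain C T where C: "compact C" "C \<subseteq> B" "C \<notin> hypergraph_ideal \<G>" "narrow_tunnel T"
      "\<And>j. C \<subseteq> (\<Union>m\<in>T j. D j m)"
      using positive_compact_enclosed[of B D] B_borel B_pos D by metis
    have "C \<in> borel_positive (hypergraph_ideal \<G>)"
      using C(1,3) by (simp add: borel_positive_def borel_compact)
    then show thesis using that C by blast
  qed
qed

section \<open>Borel reading of names below a master condition\<close>

lemma forces_enclosed_below:
  fixes \<G> :: "'a::polish_space hypergraph set"
  defines "I \<equiv> hypergraph_ideal \<G>"
  defines "P \<equiv> borel_positive I"
  assumes \<G>: "countable \<G>" "\<And>G. G \<in> \<G> \<Longrightarrow> analytic_hypergraph G"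
      "\<And>G. G \<in> \<G> \<Longrightarrow> \<exists>n. arity_le G n"
    and proper: "proper_poset P (\<subseteq>)" and p: "p \<in> P" and \<tau>: "forces_function P (\<subseteq>) p \<tau>"
  shows "\<exists>C\<in>P. C \<subseteq> p \<and> (\<exists>T. narrow_tunnel T \<and> forces_enclosed P (\<subseteq>) C \<tau> T)"
proof -
  have ideal_subset: "A \<in> I" if "B \<in> I" "A \<subseteq> B" for A B
    using that unfolding I_def hypergraph_ideal_def by (rule sigma_ideal_generated_subset)
  have ideal_UN: "(\<Union>i\<in>J. A i) \<in> I" if "countable J" "\<And>i. i \<in> J \<Longrightarrow> A i \<in> I" for J :: "'j set" and A
    using that unfolding I_def hypergraph_ideal_def by (rule sigma_ideal_generated_UN)
  have "{} \<in> I" unfolding I_def hypergraph_ideal_def sigma_ideal_generated_def by blast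
  define decides where "decides n r \<longleftrightarrow> (\<exists>m. forces_val P (\<subseteq>) r \<tau> n m)" for n r
  \<comment> \<open>Conditions incompatible with \<open>p\<close> are included to make the set dense
    in all of \<open>P\<close>, as the definition of a master condition demands.\<close>
  define Den where "Den n = {r \<in> P. \<not> compatible P (\<subseteq>) p r \<or> r \<subseteq> p \<and> decides n r}" for n
  have dense: "dense_in P (\<subseteq>) (Den n)" for n
    unfolding dense_in_def
  proof (intro conjI ballI)
    have *: "dense_below P (\<subseteq>) p (decides n)"
      using \<tau> unfolding forces_function_def decides_def by (elim conjE allE)
    fix q assume q: "q \<in> P"
    show "\<exists>d\<in>Den n. d \<subseteq> q"
    proof (cases "compatible P (\<subseteq>) p q")
      case False
      then show ?thesis using q by (auto simp: Den_def)
    next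
      case True
      then obtain r where "r \<in> P" "r \<subseteq> p" "r \<subseteq> q" unfolding compatible_def by blast
      moreover from this obtain r' where "r' \<in> P" "r' \<subseteq> r" "decides n r'"
        using * unfolding dense_below_def by blast
      ultimately show ?thesis unfolding Den_def by blast
    qed
  qed (auto simp: Den_def)
  have "\<forall>n. \<exists>d :: (('a set + nat) set set, 'a set) hset. is_set_of_atoms d (Den n)"
    by (intro allI is_set_of_atoms_exists)
  from choice[OF this] obtain d :: "nat \<Rightarrow> (('a set + nat) set set, 'a set) hset" where d: "\<And>n. is_set_of_atoms (d n) (Den n)"
    by blast
  obtain M where M: "countable M" "insert (hatom p) (range d) \<subseteq> M" "elementary_submodel P (\<subseteq>) M"
    using countable_elementary_submodel_exists[of "insert (hatom p) (range d)" P "(\<subseteq>)"] by auto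
  have "\<forall>p\<in>P. hatom p \<in> M \<longrightarrow> (\<exists>q\<in>P. q \<subseteq> p \<and> master_condition P (\<subseteq>) M q)"
    using proper[unfolded proper_poset_def, THEN spec, THEN mp, OF conjI[OF M(1,3)]] .
  then obtain q where q: "q \<in> P" "q \<subseteq> p" "master_condition P (\<subseteq>) M q"
    using p M(2) by auto
  define E where "E n = {r \<in> Den n. hatom r \<in> M \<and> r \<subseteq> p \<and> decides n r}" for n
  have EP: "E n \<subseteq> P" for n by (auto simp: E_def Den_def)
  have E_countable: "countable (E n)" for n
  proof (rule countable_image_inj_on)
    show "countable ((hatom :: _ \<Rightarrow> (('a set + nat) set set, 'a set) hset) ` E n)"
      by (rule countable_subset[OF _ M(1)]) (auto simp: E_def)
    show "inj_on (hatom :: _ \<Rightarrow> (('a set + nat) set set, 'a set) hset) (E n)"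
      by (simp add: inj_on_def hatom_inject)
  qed
  define val where "val n r = (SOME m. forces_val P (\<subseteq>) r \<tau> n m)" for n r
  have val: "forces_val P (\<subseteq>) r \<tau> n (val n r)" if "r \<in> E n" for n r
  proof -
    have "\<exists>m. forces_val P (\<subseteq>) r \<tau> n m" using that by (simp add: E_def decides_def)
    then show ?thesis unfolding val_def by (rule someI_ex)
  qed
  define D where "D n m = \<Union>{r \<in> E n. val n r = m}" for n m
  have D_borel: "D n m \<in> sets borel" for n m
    unfolding D_def using E_countable EP
    by (intro sets.countable_Union) (auto simp: P_def borel_positive_def intro: countable_subset)
  have D_UN: "(\<Union>m. D n m) = \<Union>(E n)" for n by (auto simp: D_def)
  have q_borel: "q \<in> sets borel" using q(1) by (simp add: P_def borel_positive_def)
  \<comment> \<open>These are the points of \<open>q\<close> that lie in no condition of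
    \<open>M\<close> deciding \<open>\<tau>\<close> at \<open>n\<close>. A positive such set would
    be a condition below \<open>q\<close> contradicting predensity.\<close>
  define Z where "Z n = q - (\<Union>m. D n m)" for n
  have Z_borel: "Z n \<in> sets borel" for n unfolding Z_def using q_borel D_borel by blast
  have Z: "Z n \<in> I" for n
  proof (rule ccontr)
    assume "Z n \<notin> I"
    then have "Z n \<in> P" using Z_borel by (simp add: P_def borel_positive_def)
    moreover have "Z n \<subseteq> q" by (auto simp: Z_def)
    moreover have "predense_below P (\<subseteq>) q {r \<in> Den n. hatom r \<in> M}"
      using q(3)[unfolded master_condition_def, THEN conjunct2, THEN bspec, THEN spec, THEN mp,
          OF _ conjI[OF d dense]] M(2) by auto
    ultimately obtain r r' where r: "r \<in> Den n" "hatom r \<in> M" "r' \<in> P" "r' \<subseteq> r" "r' \<subseteq> Z n"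
      unfolding predense_below_def compatible_def by blast
    \<comment> \<open>This rules out the first alternative in \<open>Den\<close>: \<open>r\<close>
      is compatible with \<open>p\<close>, hence lies below \<open>p\<close> and decides.\<close>
    have "r' \<subseteq> p" using r(5) \<open>Z n \<subseteq> q\<close> q(2) by blast
    then have "compatible P (\<subseteq>) p r" using r unfolding compatible_def by blast
    then have "r \<in> E n" using r(1,2) by (auto simp: E_def Den_def)
    then have "r' = {}" using r(4,5) D_UN[of n] by (auto simp: Z_def)
    then show False using r(3) \<open>{} \<in> I\<close> by (simp add: P_def borel_positive_def)
  qed
  define q' where "q' = q - (\<Union>n. Z n)"
  have "q' \<notin> I"
  proof
    assume "q' \<in> I"
    then have "(\<Union>i. case_nat q' Z i) \<in> I"
      using Z by (intro ideal_UN) (auto split: nat.split)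
    moreover have "q \<subseteq> (\<Union>i. case_nat q' Z i)"
    proof
      fix x assume "x \<in> q"
      show "x \<in> (\<Union>i. case_nat q' Z i)"
      proof (cases "x \<in> q'")
        case True
        then show ?thesis by (intro UN_I[of 0]) auto
      next
        case False
        then obtain n where "x \<in> Z n" using \<open>x \<in> q\<close> by (auto simp: q'_def)
        then show ?thesis by (intro UN_I[of "Suc n"]) auto
      qed
    qed
    ultimately have "q \<in> I" by (rule ideal_subset)
    then show False using q(1) by (simp add: P_def borel_positive_def)
  qed
  moreover have "q' \<in> sets borel" unfolding q'_def using q_borel Z_borel by blast
  ultimately have "q' \<in> P" by (simp add: P_def borel_positive_def)
  moreover have "q' \<subseteq> (\<Union>m. D n m)" for n by (auto simp: q'_def Z_def)
  ultimately obtain C T where C: "C \<in> P" "C \<subseteq> q'" and T: "narrow_tunnel T" "\<And>n. C \<subseteq> (\<Union>m\<in>T n. D n m)"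
    using hypergraph_positive_enclosed[OF \<G>, of q' D] D_borel unfolding P_def I_def by metis
  have "forces_enclosed P (\<subseteq>) C \<tau> T"
    unfolding forces_enclosed_def dense_below_def
  proof (intro allI ballI impI)
    fix n r assume r: "r \<in> P" "r \<subseteq> C"
    define E' where "E' = {e \<in> E n. val n e \<in> T n}"
    \<comment> \<open>The countably many deciding conditions with value in \<open>T n\<close> cover
      \<open>r\<close>. By \<sigma>-additivity one of them meets \<open>r\<close> in a positive set,
      which forces that value.\<close>
    have "r \<subseteq> (\<Union>e\<in>E'. r \<inter> e)" using r(2) T(2)[of n] by (fastforce simp: D_def E'_def)
    moreover have "r \<notin> I" using r(1) by (simp add: P_def borel_positive_def)
    ultimately have "(\<Union>e\<in>E'. r \<inter> e) \<notin> I" using ideal_subset by blast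
    moreover have "countable E'" using E_countable by (rule countable_subset[rotated]) (auto simp: E'_def)
    ultimately obtain e where e: "e \<in> E'" "r \<inter> e \<notin> I" using ideal_UN[of E' "\<lambda>e. r \<inter> e"] by blast
    have "r \<inter> e \<in> P"
      using e r(1) EP[of n] unfolding P_def borel_positive_def E'_def by blast
    moreover have "forces_val P (\<subseteq>) (r \<inter> e) \<tau> n (val n e)"
      using e(1) by (intro forces_val_mono[OF val]) (auto simp: E'_def)
    ultimately show "\<exists>r'\<in>P. r' \<subseteq> r \<and> (\<exists>m\<in>T n. forces_val P (\<subseteq>) r' \<tau> n m)"
      using e(1) by (intro bexI[of _ "r \<inter> e"]) (auto simp: E'_def)
  qed
  moreover have "C \<subseteq> p" using C(2) q(2) by (auto simp: q'_def)
  ultimately show ?thesis using C(1) T(1) by blast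
qed

theorem corollary3p12:
  fixes \<G> :: "'a::polish_space hypergraph set"
  assumes "countable \<G>"
    and "\<And>G. G \<in> \<G> \<Longrightarrow> analytic_hypergraph G"
    and "\<And>G. G \<in> \<G> \<Longrightarrow> \<exists>n. arity_le G n"
    and "proper_poset (borel_positive (hypergraph_ideal \<G>)) (\<subseteq>)"
  shows "sacks_property (borel_positive (hypergraph_ideal \<G>)) (\<subseteq>)"
  unfolding sacks_property_def
proof (intro allI ballI impI)
  let ?P = "borel_positive (hypergraph_ideal \<G>)"
  fix \<tau> p assume "p \<in> ?P" and \<tau>: "forces_function ?P (\<subseteq>) p \<tau>"
  show "dense_below ?P (\<subseteq>) p (\<lambda>q. \<exists>T. narrow_tunnel T \<and> forces_enclosed ?P (\<subseteq>) q \<tau> T)"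
    unfolding dense_below_def
  proof (intro ballI impI)
    fix q assume "q \<in> ?P" "q \<subseteq> p"
    from forces_enclosed_below[OF assms this(1) forces_function_mono[OF \<tau> this(2)]]
    show "\<exists>r\<in>?P. r \<subseteq> q \<and> (\<exists>T. narrow_tunnel T \<and> forces_enclosed ?P (\<subseteq>) r \<tau> T)" .
  qed
qed

end
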